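(* Let $R$ be a unitary ring, and let $M$ be a right $R$-module. The following hold both with all words in parentheses omitted and with all of them included. (1) Assume that $M$ is finitely cogenerated or $R$ is a right semiartinian ring. Then $M$ is (strongly) self-CS-Baer if and only if $M$ is (strongly) self-CS-Rickart and (strictly) SSIP-extending. (2) Assume that $M$ is finitely generated or $R$ is a right max ring. Then $M$ is dual (strongly) self-CS-Baer if and only if $M$ is dual (strongly) self-CS-Rickart and (strictly) SSSP-lifting.
   Context: A ring $R$ is right semiartinian if every non-zero right $R$-module has non-zero socle, and right max if every non-zero right $R$-module has a maximal submodule. A submodule $K$ of $M$ is fully invariant if $h(K)\subseteq K$ for every endomorphism $h$ of $M$. A submodule $L$ of $M$ lies above a direct summand $K$ of $M$ if $K\subseteq L$ and $L/K$ is superfluous in $M/K$ (a submodule $A$ of $B$ is superfluous if $A+X=B$ implies $X=B$ for every submodule $X$ of $B$). A right $R$-module $M$ is: (strongly) self-CS-Rickart if for every endomorphism $f$ of $M$, $\mathrm{Ker}(f)$ is essential in a (fully invariant) direct summand of $M$; dual (strongly) self-CS-Rickart if for every endomorphism $f$ of $M$, $\mathrm{Im}(f)$ lies above a (fully invariant) direct summand of $M$; (strongly) self-CS-Baer if for every family $(f_i)_{i\in I}$ of endomorphisms of $M$, $\bigcap_{i\in I}\mathrm{Ker}(f_i)$ is essential in a (fully invariant) direct summand of $M$; dual (strongly) self-CS-Baer if for every such family $\sum_{i\in I}\mathrm{Im}(f_i)$ lies above a (fully invariant) direct summand of $M$; (strictly) SSIP-extending if for any family of submodules of $M$ which are essential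 in direct summands of $M$, their intersection is essential in a (fully invariant) direct summand of $M$; (strictly) SSSP-lifting if for any family of submodules of $M$ which lie above direct summands of $M$, their sum lies above a (fully invariant) direct summand of $M$. *)

theory Defs
  imports "HOL-Algebra.AbelCoset" "HOL-Algebra.Module"
begin

text \<open>
  Right modules use the record type of the library's (left, commutative) modules:
  the term \<open>r \<odot>\<^bsub>M\<^esub> x\<close> stands for the product of \<open>x\<close> by \<open>r\<close> on the right,
  so that \<open>smult_assoc\<close> below is the law that \<open>x\<close> times \<open>r s\<close> is \<open>x r\<close> times \<open>s\<close>.
  The library locale \<open>submodule\<close> only requires an additive subgroup that is closed under
  \<open>smult\<close>, hence it is the right notion for right modules, too.
\<close>

locale right_module = R?: ring R + M?: abelian_group M
  for R :: "('r, 'k) ring_scheme" and M :: "('r, 'm, 'l) module_scheme" (structure) +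
  assumes smult_closed:
      "\<lbrakk>r \<in> carrier R; x \<in> carrier M\<rbrakk> \<Longrightarrow> r \<odot>\<^bsub>M\<^esub> x \<in> carrier M"
    and smult_l_distr:
      "\<lbrakk>r \<in> carrier R; s \<in> carrier R; x \<in> carrier M\<rbrakk> \<Longrightarrow>
        (r \<oplus>\<^bsub>R\<^esub> s) \<odot>\<^bsub>M\<^esub> x = (r \<odot>\<^bsub>M\<^esub> x) \<oplus>\<^bsub>M\<^esub> (s \<odot>\<^bsub>M\<^esub> x)"
    and smult_r_distr:
      "\<lbrakk>r \<in> carrier R; x \<in> carrier M; y \<in> carrier M\<rbrakk> \<Longrightarrow>
        r \<odot>\<^bsub>M\<^esub> (x \<oplus>\<^bsub>M\<^esub> y) = (r \<odot>\<^bsub>M\<^esub> x) \<oplus>\<^bsub>M\<^esub> (r \<odot>\<^bsub>M\<^esub> y)"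
    and smult_assoc:
      "\<lbrakk>r \<in> carrier R; s \<in> carrier R; x \<in> carrier M\<rbrakk> \<Longrightarrow>
        (r \<otimes>\<^bsub>R\<^esub> s) \<odot>\<^bsub>M\<^esub> x = s \<odot>\<^bsub>M\<^esub> (r \<odot>\<^bsub>M\<^esub> x)"
    and smult_one:
      "x \<in> carrier M \<Longrightarrow> \<one>\<^bsub>R\<^esub> \<odot>\<^bsub>M\<^esub> x = x"

definition submodule_span ::
    "('r, 'k) ring_scheme \<Rightarrow> ('r, 'm, 'l) module_scheme \<Rightarrow> 'm set \<Rightarrow> 'm set" where
  "submodule_span R M S = \<Inter>{N. submodule N R M \<and> S \<subseteq> N}"

text \<open>Intersections and sums of families only depend on the set of members, so families are
  sets of submodules. The intersection of the empty family is the whole module, its sum is 0.\<close>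

definition submodule_Inter ::
    "('r, 'm, 'l) module_scheme \<Rightarrow> 'm set set \<Rightarrow> 'm set" where
  "submodule_Inter M \<N> = carrier M \<inter> \<Inter>\<N>"

definition submodule_Sum ::
    "('r, 'k) ring_scheme \<Rightarrow> ('r, 'm, 'l) module_scheme \<Rightarrow> 'm set set \<Rightarrow> 'm set" where
  "submodule_Sum R M \<N> = submodule_span R M (\<Union>\<N>)"

text \<open>The fields \<open>mult\<close> and \<open>one\<close> exist only because the record \<open>module\<close> extends \<open>ring\<close>;
  they play no role. Scalar multiplication sends \<open>K + x\<close> to \<open>K + x r\<close>.\<close>

definition quotient_module ::
    "('r, 'm, 'l) module_scheme \<Rightarrow> 'm set \<Rightarrow> ('r, 'm set) module" where
  "quotient_module M K =
    \<lparr>carrier = a_rcosets\<^bsub>M\<^esub> K, mult = undefined, one = undefined,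
     zero = K, add = set_add M, smult = (\<lambda>r X. \<Union>x\<in>X. K +>\<^bsub>M\<^esub> (r \<odot>\<^bsub>M\<^esub> x))\<rparr>"

definition quotient_submodule ::
    "('r, 'm, 'l) module_scheme \<Rightarrow> 'm set \<Rightarrow> 'm set \<Rightarrow> 'm set set" where
  "quotient_submodule M L K = (\<lambda>x. K +>\<^bsub>M\<^esub> x) ` L"

definition endomorphisms ::
    "('r, 'k) ring_scheme \<Rightarrow> ('r, 'm, 'l) module_scheme \<Rightarrow> ('m \<Rightarrow> 'm) set" where
  "endomorphisms R M =
    {h \<in> hom (add_monoid M) (add_monoid M).
       \<forall>r\<in>carrier R. \<forall>x\<in>carrier M. h (r \<odot>\<^bsub>M\<^esub> x) = r \<odot>\<^bsub>M\<^esub> h x}"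

definition fully_invariant ::
    "('r, 'k) ring_scheme \<Rightarrow> ('r, 'm, 'l) module_scheme \<Rightarrow> 'm set \<Rightarrow> bool" where
  "fully_invariant R M K \<longleftrightarrow> submodule K R M \<and> (\<forall>h\<in>endomorphisms R M. h ` K \<subseteq> K)"

definition direct_summand ::
    "('r, 'k) ring_scheme \<Rightarrow> ('r, 'm, 'l) module_scheme \<Rightarrow> 'm set \<Rightarrow> bool" where
  "direct_summand R M K \<longleftrightarrow>
    submodule K R M \<and>
    (\<exists>K'. submodule K' R M \<and> K \<inter> K' = {\<zero>\<^bsub>M\<^esub>} \<and> K <+>\<^bsub>M\<^esub> K' = carrier M)"

definition essential_in ::
    "('r, 'k) ring_scheme \<Rightarrow> ('r, 'm, 'l) module_scheme \<Rightarrow> 'm set \<Rightarrow> 'm set \<Rightarrow> bool" where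
  "essential_in R M L K \<longleftrightarrow>
    submodule L R M \<and> submodule K R M \<and> L \<subseteq> K \<and>
    (\<forall>X. submodule X R M \<longrightarrow> X \<subseteq> K \<longrightarrow> L \<inter> X = {\<zero>\<^bsub>M\<^esub>} \<longrightarrow> X = {\<zero>\<^bsub>M\<^esub>})"

definition superfluous ::
    "('r, 'k) ring_scheme \<Rightarrow> ('r, 'm, 'l) module_scheme \<Rightarrow> 'm set \<Rightarrow> bool" where
  "superfluous R B A \<longleftrightarrow>
    submodule A R B \<and>
    (\<forall>X. submodule X R B \<longrightarrow> A <+>\<^bsub>B\<^esub> X = carrier B \<longrightarrow> X = carrier B)"

definition lies_above ::
    "('r, 'k) ring_scheme \<Rightarrow> ('r, 'm, 'l) module_scheme \<Rightarrow> 'm set \<Rightarrow> 'm set \<Rightarrow> bool" where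
  "lies_above R M L K \<longleftrightarrow>
    submodule L R M \<and> submodule K R M \<and> K \<subseteq> L \<and>
    superfluous R (quotient_module M K) (quotient_submodule M L K)"

definition simple_submodule ::
    "('r, 'k) ring_scheme \<Rightarrow> ('r, 'm, 'l) module_scheme \<Rightarrow> 'm set \<Rightarrow> bool" where
  "simple_submodule R M S \<longleftrightarrow>
    submodule S R M \<and> S \<noteq> {\<zero>\<^bsub>M\<^esub>} \<and>
    (\<forall>X. submodule X R M \<longrightarrow> X \<subseteq> S \<longrightarrow> X = {\<zero>\<^bsub>M\<^esub>} \<or> X = S)"

definition socle ::
    "('r, 'k) ring_scheme \<Rightarrow> ('r, 'm, 'l) module_scheme \<Rightarrow> 'm set" where
  "socle R M = submodule_Sum R M {S. simple_submodule R M S}"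

definition maximal_submodule ::
    "('r, 'k) ring_scheme \<Rightarrow> ('r, 'm, 'l) module_scheme \<Rightarrow> 'm set \<Rightarrow> bool" where
  "maximal_submodule R M N \<longleftrightarrow>
    submodule N R M \<and> N \<noteq> carrier M \<and>
    (\<forall>X. submodule X R M \<longrightarrow> N \<subseteq> X \<longrightarrow> X = N \<or> X = carrier M)"

definition finitely_generated ::
    "('r, 'k) ring_scheme \<Rightarrow> ('r, 'm, 'l) module_scheme \<Rightarrow> bool" where
  "finitely_generated R M \<longleftrightarrow>
    (\<exists>S. finite S \<and> S \<subseteq> carrier M \<and> submodule_span R M S = carrier M)"

definition finitely_cogenerated ::
    "('r, 'k) ring_scheme \<Rightarrow> ('r, 'm, 'l) module_scheme \<Rightarrow> bool" where
  "finitely_cogenerated R M \<longleftrightarrow>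
    (\<forall>\<N>. (\<forall>N\<in>\<N>. submodule N R M) \<longrightarrow> submodule_Inter M \<N> = {\<zero>\<^bsub>M\<^esub>} \<longrightarrow>
      (\<exists>\<F>. finite \<F> \<and> \<F> \<subseteq> \<N> \<and> submodule_Inter M \<F> = {\<zero>\<^bsub>M\<^esub>}))"

text \<open>
  HOL cannot quantify over the types of the carriers of all modules, so the next two
  definitions take the type of the carriers as a parameter. They express the absolute notions
  as soon as \<open>'r set\<close> embeds into this type:

  \<^item> a non-zero module contains a non-zero cyclic module, which is isomorphic to the quotient of
    \<open>R\<close> by a right ideal;

  \<^item> let a non-zero module \<open>N\<close> have no maximal submodule. Then \<open>R\<close> is infinite (over a finite
    ring every non-zero module has a maximal submodule). Take \<open>x \<noteq> 0\<close> in \<open>N\<close>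
    and a submodule maximal among those not containing \<open>x\<close>. The quotient of \<open>N\<close> by it has no
    maximal submodule and embeds into the injective hull of a simple module, which has at most
    as many elements as there are subsets of \<open>R\<close>.
\<close>

definition right_semiartinian :: "'u itself \<Rightarrow> ('r, 'k) ring_scheme \<Rightarrow> bool" where
  "right_semiartinian U R \<longleftrightarrow>
    (\<forall>N :: ('r, 'u) module. right_module R N \<longrightarrow> carrier N \<noteq> {\<zero>\<^bsub>N\<^esub>} \<longrightarrow>
      socle R N \<noteq> {\<zero>\<^bsub>N\<^esub>})"

definition right_max :: "'u itself \<Rightarrow> ('r, 'k) ring_scheme \<Rightarrow> bool" where
  "right_max U R \<longleftrightarrow>
    (\<forall>N :: ('r, 'u) module. right_module R N \<longrightarrow> carrier N \<noteq> {\<zero>\<^bsub>N\<^esub>} \<longrightarrow>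
      (\<exists>K. maximal_submodule R N K))"

definition self_CS_Rickart ::
    "('r, 'k) ring_scheme \<Rightarrow> ('r, 'm, 'l) module_scheme \<Rightarrow> bool" where
  "self_CS_Rickart R M \<longleftrightarrow>
    (\<forall>f\<in>endomorphisms R M. \<exists>K. direct_summand R M K \<and>
      essential_in R M (a_kernel M M f) K)"

definition strongly_self_CS_Rickart ::
    "('r, 'k) ring_scheme \<Rightarrow> ('r, 'm, 'l) module_scheme \<Rightarrow> bool" where
  "strongly_self_CS_Rickart R M \<longleftrightarrow>
    (\<forall>f\<in>endomorphisms R M. \<exists>K. direct_summand R M K \<and> fully_invariant R M K \<and>
      essential_in R M (a_kernel M M f) K)"

definition dual_self_CS_Rickart ::
    "('r, 'k) ring_scheme \<Rightarrow> ('r, 'm, 'l) module_scheme \<Rightarrow> bool" where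
  "dual_self_CS_Rickart R M \<longleftrightarrow>
    (\<forall>f\<in>endomorphisms R M. \<exists>K. direct_summand R M K \<and>
      lies_above R M (f ` carrier M) K)"

definition dual_strongly_self_CS_Rickart ::
    "('r, 'k) ring_scheme \<Rightarrow> ('r, 'm, 'l) module_scheme \<Rightarrow> bool" where
  "dual_strongly_self_CS_Rickart R M \<longleftrightarrow>
    (\<forall>f\<in>endomorphisms R M. \<exists>K. direct_summand R M K \<and> fully_invariant R M K \<and>
      lies_above R M (f ` carrier M) K)"

definition self_CS_Baer ::
    "('r, 'k) ring_scheme \<Rightarrow> ('r, 'm, 'l) module_scheme \<Rightarrow> bool" where
  "self_CS_Baer R M \<longleftrightarrow>
    (\<forall>F \<subseteq> endomorphisms R M. \<exists>K. direct_summand R M K \<and>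
      essential_in R M (submodule_Inter M (a_kernel M M ` F)) K)"

definition strongly_self_CS_Baer ::
    "('r, 'k) ring_scheme \<Rightarrow> ('r, 'm, 'l) module_scheme \<Rightarrow> bool" where
  "strongly_self_CS_Baer R M \<longleftrightarrow>
    (\<forall>F \<subseteq> endomorphisms R M. \<exists>K. direct_summand R M K \<and> fully_invariant R M K \<and>
      essential_in R M (submodule_Inter M (a_kernel M M ` F)) K)"

definition dual_self_CS_Baer ::
    "('r, 'k) ring_scheme \<Rightarrow> ('r, 'm, 'l) module_scheme \<Rightarrow> bool" where
  "dual_self_CS_Baer R M \<longleftrightarrow>
    (\<forall>F \<subseteq> endomorphisms R M. \<exists>K. direct_summand R M K \<and>
      lies_above R M (submodule_Sum R M ((\<lambda>f. f ` carrier M) ` F)) K)"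

definition dual_strongly_self_CS_Baer ::
    "('r, 'k) ring_scheme \<Rightarrow> ('r, 'm, 'l) module_scheme \<Rightarrow> bool" where
  "dual_strongly_self_CS_Baer R M \<longleftrightarrow>
    (\<forall>F \<subseteq> endomorphisms R M. \<exists>K. direct_summand R M K \<and> fully_invariant R M K \<and>
      lies_above R M (submodule_Sum R M ((\<lambda>f. f ` carrier M) ` F)) K)"

definition SSIP_extending ::
    "('r, 'k) ring_scheme \<Rightarrow> ('r, 'm, 'l) module_scheme \<Rightarrow> bool" where
  "SSIP_extending R M \<longleftrightarrow>
    (\<forall>\<N>. (\<forall>N\<in>\<N>. \<exists>D. direct_summand R M D \<and> essential_in R M N D) \<longrightarrow>
      (\<exists>K. direct_summand R M K \<and> essential_in R M (submodule_Inter M \<N>) K))"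

definition strictly_SSIP_extending ::
    "('r, 'k) ring_scheme \<Rightarrow> ('r, 'm, 'l) module_scheme \<Rightarrow> bool" where
  "strictly_SSIP_extending R M \<longleftrightarrow>
    (\<forall>\<N>. (\<forall>N\<in>\<N>. \<exists>D. direct_summand R M D \<and> essential_in R M N D) \<longrightarrow>
      (\<exists>K. direct_summand R M K \<and> fully_invariant R M K \<and>
        essential_in R M (submodule_Inter M \<N>) K))"

definition SSSP_lifting ::
    "('r, 'k) ring_scheme \<Rightarrow> ('r, 'm, 'l) module_scheme \<Rightarrow> bool" where
  "SSSP_lifting R M \<longleftrightarrow>
    (\<forall>\<N>. (\<forall>N\<in>\<N>. \<exists>D. direct_summand R M D \<and> lies_above R M N D) \<longrightarrow>
      (\<exists>K. direct_summand R M K \<and> lies_above R M (submodule_Sum R M \<N>) K))"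

definition strictly_SSSP_lifting ::
    "('r, 'k) ring_scheme \<Rightarrow> ('r, 'm, 'l) module_scheme \<Rightarrow> bool" where
  "strictly_SSSP_lifting R M \<longleftrightarrow>
    (\<forall>\<N>. (\<forall>N\<in>\<N>. \<exists>D. direct_summand R M D \<and> lies_above R M N D) \<longrightarrow>
      (\<exists>K. direct_summand R M K \<and> fully_invariant R M K \<and>
        lies_above R M (submodule_Sum R M \<N>) K))"

end

theory Submission
  imports Defs
begin

text \<open>
  A direct summand is both the kernel and the image of an idempotent endomorphism. So (CS-)Baer
  modules control intersections of kernels of projections, and what remains is to compare the
  intersection of submodules \<open>N\<^sub>i\<close> with the intersection of summands \<open>D\<^sub>i\<close> in which they are
  essential. If every non-zero submodule of \<open>M\<close> contains a simple submodule, essential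
  submodules are detected by simple ones: a simple submodule of all \<open>D\<^sub>i\<close> meets every \<open>N\<^sub>i\<close>
  and so lies in all of them. Dually, if every proper submodule is contained in a maximal one,
  then a maximal submodule containing all \<open>D\<^sub>i\<close> contains every \<open>N\<^sub>i\<close> lying above \<open>D\<^sub>i\<close>.
  Zorn's lemma gives the first property for finitely cogenerated modules and the second one for
  finitely generated modules; for semiartinian and max rings they come from the module given by
  a submodule and by a quotient, respectively.
\<close>

section \<open>Submodules\<close>

lemma submodule_subset: "submodule N R M \<Longrightarrow> N \<subseteq> carrier M"
  using subgroup.subset[OF submodule.axioms(1)] by fastforce

lemma submodule_zero: "submodule N R M \<Longrightarrow> \<zero>\<^bsub>M\<^esub> \<in> N"
  using subgroup.one_closed[OF submodule.axioms(1)] by fastforce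

lemma submodule_add:
  "submodule N R M \<Longrightarrow> x \<in> N \<Longrightarrow> y \<in> N \<Longrightarrow> x \<oplus>\<^bsub>M\<^esub> y \<in> N"
  using subgroup.m_closed[OF submodule.axioms(1)] by fastforce

lemma submodule_a_inv: "submodule N R M \<Longrightarrow> x \<in> N \<Longrightarrow> \<ominus>\<^bsub>M\<^esub> x \<in> N"
  unfolding a_inv_def using subgroup.m_inv_closed[OF submodule.axioms(1)] by fastforce

lemma submodule_smult:
  "submodule N R M \<Longrightarrow> r \<in> carrier R \<Longrightarrow> x \<in> N \<Longrightarrow> r \<odot>\<^bsub>M\<^esub> x \<in> N"
  by (rule submodule.smult_closed)

lemma mem_set_add: "z \<in> A <+>\<^bsub>M\<^esub> B \<longleftrightarrow> (\<exists>a\<in>A. \<exists>b\<in>B. z = a \<oplus>\<^bsub>M\<^esub> b)"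
  by (auto simp: set_add_def')

lemma mem_a_kernel: "x \<in> a_kernel M N f \<longleftrightarrow> x \<in> carrier M \<and> f x = \<zero>\<^bsub>N\<^esub>"
  by (simp add: a_kernel_def kernel_def)

context right_module
begin

lemma smult_zero: "r \<in> carrier R \<Longrightarrow> r \<odot>\<^bsub>M\<^esub> \<zero>\<^bsub>M\<^esub> = \<zero>\<^bsub>M\<^esub>"
  using smult_r_distr[of r "\<zero>\<^bsub>M\<^esub>" "\<zero>\<^bsub>M\<^esub>"] smult_closed[of r "\<zero>\<^bsub>M\<^esub>"] by simp

lemma zero_smult: "x \<in> carrier M \<Longrightarrow> \<zero>\<^bsub>R\<^esub> \<odot>\<^bsub>M\<^esub> x = \<zero>\<^bsub>M\<^esub>"
  using smult_l_distr[of "\<zero>\<^bsub>R\<^esub>" "\<zero>\<^bsub>R\<^esub>" x] smult_closed[of "\<zero>\<^bsub>R\<^esub>" x] by simp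

lemma smult_minus_one:
  assumes "x \<in> carrier M"
  shows "(\<ominus>\<^bsub>R\<^esub> \<one>\<^bsub>R\<^esub>) \<odot>\<^bsub>M\<^esub> x = \<ominus>\<^bsub>M\<^esub> x"
proof -
  have "(\<ominus>\<^bsub>R\<^esub> \<one>\<^bsub>R\<^esub>) \<odot>\<^bsub>M\<^esub> x \<oplus>\<^bsub>M\<^esub> x = (\<ominus>\<^bsub>R\<^esub> \<one>\<^bsub>R\<^esub> \<oplus>\<^bsub>R\<^esub> \<one>\<^bsub>R\<^esub>) \<odot>\<^bsub>M\<^esub> x"
    using assms by (simp add: smult_l_distr smult_one)
  then have "(\<ominus>\<^bsub>R\<^esub> \<one>\<^bsub>R\<^esub>) \<odot>\<^bsub>M\<^esub> x \<oplus>\<^bsub>M\<^esub> x = \<zero>\<^bsub>M\<^esub>"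
    using assms by (simp add: zero_smult R.l_neg)
  then show ?thesis
    using assms by (simp add: M.minus_equality smult_closed)
qed

text \<open>Negatives come for free: \<open>smult_minus_one\<close> writes the negative of
  \<open>x\<close> as the product of \<open>x\<close> by minus one, so closure under scalars covers
  them.\<close>

lemma submoduleI:
  assumes "N \<subseteq> carrier M" and "\<zero>\<^bsub>M\<^esub> \<in> N"
    and "\<And>x y. x \<in> N \<Longrightarrow> y \<in> N \<Longrightarrow> x \<oplus>\<^bsub>M\<^esub> y \<in> N"
    and smult: "\<And>r x. r \<in> carrier R \<Longrightarrow> x \<in> N \<Longrightarrow> r \<odot>\<^bsub>M\<^esub> x \<in> N"
  shows "submodule N R M"
proof -
  have "\<ominus>\<^bsub>M\<^esub> x \<in> N" if "x \<in> N" for x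
    using that assms(1) smult[of "\<ominus>\<^bsub>R\<^esub> \<one>\<^bsub>R\<^esub>" x] smult_minus_one[of x] by auto
  then show ?thesis
    using assms by (intro submodule.intro subgroup.intro) (auto simp: submodule_axioms_def a_inv_def)
qed

lemma submodule_carrier: "submodule (carrier M) R M"
  by (rule submoduleI) (auto intro: smult_closed)

lemma submodule_zero_module: "submodule {\<zero>\<^bsub>M\<^esub>} R M"
  by (rule submoduleI) (auto simp: smult_zero)

lemma submodule_submodule_Inter:
  assumes "\<And>N. N \<in> \<N> \<Longrightarrow> submodule N R M"
  shows "submodule (submodule_Inter M \<N>) R M"
  unfolding submodule_Inter_def
  by (rule submoduleI)
    (auto intro: smult_closed submodule_zero[OF assms] submodule_add[OF assms]
      submodule_smult[OF assms])

lemma submodule_Int: "submodule A R M \<Longrightarrow> submodule B R M \<Longrightarrow> submodule (A \<inter> B) R M"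
  by (rule submoduleI) (auto dest: submodule_subset submodule_zero submodule_add submodule_smult)

text \<open>Only addition uses the chain condition: of the two members containing \<open>x\<close>
  and \<open>y\<close>, one contains the other and hence the sum. Non-emptiness supplies the
  zero.\<close>

lemma submodule_Union_chain:
  assumes "subset.chain {N. submodule N R M} \<C>" and "\<C> \<noteq> {}"
  shows "submodule (\<Union>\<C>) R M"
proof (rule submoduleI)
  have sub: "submodule N R M" if "N \<in> \<C>" for N
    using assms(1) that by (auto simp: subset_chain_def)
  show "\<Union>\<C> \<subseteq> carrier M"
    using submodule_subset[OF sub] by blast
  show "\<zero>\<^bsub>M\<^esub> \<in> \<Union>\<C>"
    using assms(2) submodule_zero[OF sub] by blast
  show "r \<odot>\<^bsub>M\<^esub> x \<in> \<Union>\<C>" if "r \<in> carrier R" "x \<in> \<Union>\<C>" for r x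
    using that submodule_smult[OF sub] by blast
  show "x \<oplus>\<^bsub>M\<^esub> y \<in> \<Union>\<C>" if xy: "x \<in> \<Union>\<C>" "y \<in> \<Union>\<C>" for x y
  proof -
    obtain A B where "A \<in> \<C>" "B \<in> \<C>" "x \<in> A" "y \<in> B"
      using xy by blast
    moreover have "A \<subseteq> B \<or> B \<subseteq> A"
      using assms(1) calculation unfolding subset_chain_def by blast
    ultimately show ?thesis
      using submodule_add[OF sub, of A x y] submodule_add[OF sub, of B x y] by blast
  qed
qed

lemma submodule_set_add:
  assumes A: "submodule A R M" and B: "submodule B R M"
  shows "submodule (A <+>\<^bsub>M\<^esub> B) R M"
proof (rule submoduleI)
  have [simp]: "x \<in> carrier M" if "x \<in> A \<or> x \<in> B" for x
    using that submodule_subset[OF A] submodule_subset[OF B] by blast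
  show "A <+>\<^bsub>M\<^esub> B \<subseteq> carrier M"
    by (auto simp: mem_set_add)
  show "\<zero>\<^bsub>M\<^esub> \<in> A <+>\<^bsub>M\<^esub> B"
    using submodule_zero[OF A] submodule_zero[OF B] by (force simp: mem_set_add)
  show "r \<odot>\<^bsub>M\<^esub> x \<in> A <+>\<^bsub>M\<^esub> B" if "r \<in> carrier R" "x \<in> A <+>\<^bsub>M\<^esub> B" for r x
    using that submodule_smult[OF A] submodule_smult[OF B]
    by (force simp: mem_set_add smult_r_distr)
  show "x \<oplus>\<^bsub>M\<^esub> y \<in> A <+>\<^bsub>M\<^esub> B" if xy: "x \<in> A <+>\<^bsub>M\<^esub> B" "y \<in> A <+>\<^bsub>M\<^esub> B" for x y
  proof -
    obtain a b a' b' where *: "a \<in> A" "b \<in> B" "a' \<in> A" "b' \<in> B"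
      and "x = a \<oplus>\<^bsub>M\<^esub> b" "y = a' \<oplus>\<^bsub>M\<^esub> b'"
      using xy by (auto simp: mem_set_add)
    then have "x \<oplus>\<^bsub>M\<^esub> y = (a \<oplus>\<^bsub>M\<^esub> a') \<oplus>\<^bsub>M\<^esub> (b \<oplus>\<^bsub>M\<^esub> b')"
      by (simp add: M.a_ac)
    then show ?thesis
      unfolding mem_set_add using * submodule_add[OF A] submodule_add[OF B] by blast
  qed
qed

lemma set_add_least:
  "submodule N R M \<Longrightarrow> A \<subseteq> N \<Longrightarrow> B \<subseteq> N \<Longrightarrow> A <+>\<^bsub>M\<^esub> B \<subseteq> N"
  by (auto simp: mem_set_add intro!: submodule_add)

lemma set_add_upper:
  assumes "submodule A R M" and "submodule B R M"
  shows "A \<subseteq> A <+>\<^bsub>M\<^esub> B" and "B \<subseteq> A <+>\<^bsub>M\<^esub> B"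
proof -
  have "x \<oplus>\<^bsub>M\<^esub> \<zero>\<^bsub>M\<^esub> = x" if "x \<in> A" for x
    using that submodule_subset[OF assms(1)] by auto
  moreover have "\<zero>\<^bsub>M\<^esub> \<oplus>\<^bsub>M\<^esub> x = x" if "x \<in> B" for x
    using that submodule_subset[OF assms(2)] by auto
  ultimately show "A \<subseteq> A <+>\<^bsub>M\<^esub> B" "B \<subseteq> A <+>\<^bsub>M\<^esub> B"
    using submodule_zero[OF assms(1)] submodule_zero[OF assms(2)]
    by (force simp: mem_set_add)+
qed

section \<open>Spans and sums of families\<close>

lemma submodule_submodule_span:
  assumes "S \<subseteq> carrier M"
  shows "submodule (submodule_span R M S) R M"
proof -
  \<comment> \<open>The whole module is one of the submodules containing \<open>S\<close>, so
    cutting down to \<open>carrier M\<close> changes nothing.\<close>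
  have "submodule_span R M S = submodule_Inter M {N. submodule N R M \<and> S \<subseteq> N}"
    using assms submodule_carrier by (auto simp: submodule_span_def submodule_Inter_def)
  then show ?thesis
    using submodule_submodule_Inter[of "{N. submodule N R M \<and> S \<subseteq> N}"] by simp
qed

lemma submodule_submodule_Sum:
  assumes "\<And>N. N \<in> \<N> \<Longrightarrow> submodule N R M"
  shows "submodule (submodule_Sum R M \<N>) R M"
  unfolding submodule_Sum_def
  using assms submodule_subset by (intro submodule_submodule_span) blast

end

lemma submodule_span_least: "submodule N R M \<Longrightarrow> S \<subseteq> N \<Longrightarrow> submodule_span R M S \<subseteq> N"
  by (auto simp: submodule_span_def)

lemma submodule_Sum_least:
  "submodule N R M \<Longrightarrow> (\<And>A. A \<in> \<N> \<Longrightarrow> A \<subseteq> N) \<Longrightarrow> submodule_Sum R M \<N> \<subseteq> N"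
  unfolding submodule_Sum_def by (rule submodule_span_least) blast+

lemma submodule_Sum_upper: "A \<in> \<N> \<Longrightarrow> A \<subseteq> submodule_Sum R M \<N>"
  by (auto simp: submodule_Sum_def submodule_span_def)

section \<open>Linear maps\<close>

text \<open>Source and target may have different types, as quotients and copies of modules require.
  The target is not assumed to be a module, so preservation of zero cannot be derived from
  additivity and is part of the definition.\<close>

definition linear_map ::
    "('r, 'k) ring_scheme \<Rightarrow> ('r, 'm, 'l) module_scheme \<Rightarrow> ('r, 'n, 'j) module_scheme \<Rightarrow>
      ('m \<Rightarrow> 'n) \<Rightarrow> bool" where
  "linear_map R M N h \<longleftrightarrow> h \<in> carrier M \<rightarrow> carrier N \<and> h \<zero>\<^bsub>M\<^esub> = \<zero>\<^bsub>N\<^esub> \<and>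
    (\<forall>x\<in>carrier M. \<forall>y\<in>carrier M. h (x \<oplus>\<^bsub>M\<^esub> y) = h x \<oplus>\<^bsub>N\<^esub> h y) \<and>
    (\<forall>r\<in>carrier R. \<forall>x\<in>carrier M. h (r \<odot>\<^bsub>M\<^esub> x) = r \<odot>\<^bsub>N\<^esub> h x)"

lemma linear_mapD:
  assumes "linear_map R M N h"
  shows "x \<in> carrier M \<Longrightarrow> h x \<in> carrier N" and "h \<zero>\<^bsub>M\<^esub> = \<zero>\<^bsub>N\<^esub>"
    and "x \<in> carrier M \<Longrightarrow> y \<in> carrier M \<Longrightarrow> h (x \<oplus>\<^bsub>M\<^esub> y) = h x \<oplus>\<^bsub>N\<^esub> h y"
    and "r \<in> carrier R \<Longrightarrow> x \<in> carrier M \<Longrightarrow> h (r \<odot>\<^bsub>M\<^esub> x) = r \<odot>\<^bsub>N\<^esub> h x"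
  using assms by (auto simp: linear_map_def)

lemma linear_map_comp:
  "linear_map R M N g \<Longrightarrow> linear_map R N P h \<Longrightarrow> linear_map R M P (h \<circ> g)"
  by (auto simp: linear_map_def Pi_iff)

context right_module
begin

text \<open>Every element of \<open>N\<close> has a preimage, and \<open>h\<close> carries the
  module laws of \<open>M\<close> over to \<open>N\<close>. Quotients and transported copies thus
  become modules without checking the axioms on their concrete operations.\<close>

lemma right_module_linear_image:
  assumes h: "linear_map R M N h" and surj: "h ` carrier M = carrier N"
  shows "right_module R N"
proof -
  have car: "h x \<in> carrier N" if "x \<in> carrier M" for x
    using that surj by blast
  have sum: "h x \<oplus>\<^bsub>N\<^esub> h y = h (x \<oplus>\<^bsub>M\<^esub> y)" if "x \<in> carrier M" "y \<in> carrier M" for x y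
    using linear_mapD(3)[OF h that] by simp
  have scal: "r \<odot>\<^bsub>N\<^esub> h x = h (r \<odot>\<^bsub>M\<^esub> x)" if "r \<in> carrier R" "x \<in> carrier M" for r x
    using linear_mapD(4)[OF h that] by simp
  have zero: "\<zero>\<^bsub>N\<^esub> = h \<zero>\<^bsub>M\<^esub>"
    using linear_mapD(2)[OF h] by simp
  have rep: "\<exists>x'\<in>carrier M. x = h x'" if "x \<in> carrier N" for x
    using that surj by blast
  have "abelian_group N"
  proof (rule abelian_groupI)
    show "\<zero>\<^bsub>N\<^esub> \<in> carrier N"
      using car zero by simp
  next
    fix x y assume "x \<in> carrier N" "y \<in> carrier N"
    then obtain x' y' where *: "x' \<in> carrier M" "x = h x'" "y' \<in> carrier M" "y = h y'"
      using rep by meson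
    then show "x \<oplus>\<^bsub>N\<^esub> y \<in> carrier N"
      using car by (simp add: sum)
    show "x \<oplus>\<^bsub>N\<^esub> y = y \<oplus>\<^bsub>N\<^esub> x"
      using * by (simp add: sum M.a_comm)
  next
    fix x y z assume "x \<in> carrier N" "y \<in> carrier N" "z \<in> carrier N"
    then obtain x' y' z' where
      "x' \<in> carrier M" "x = h x'" "y' \<in> carrier M" "y = h y'" "z' \<in> carrier M" "z = h z'"
      using rep by meson
    then show "x \<oplus>\<^bsub>N\<^esub> y \<oplus>\<^bsub>N\<^esub> z = x \<oplus>\<^bsub>N\<^esub> (y \<oplus>\<^bsub>N\<^esub> z)"
      by (simp add: sum M.a_assoc)
  next
    fix x assume "x \<in> carrier N"
    then obtain x' where x': "x' \<in> carrier M" "x = h x'"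
      using rep by meson
    then show "\<zero>\<^bsub>N\<^esub> \<oplus>\<^bsub>N\<^esub> x = x"
      by (simp add: sum zero)
    have "h (\<ominus>\<^bsub>M\<^esub> x') \<oplus>\<^bsub>N\<^esub> x = \<zero>\<^bsub>N\<^esub>"
      using x' by (simp add: sum zero M.l_neg)
    then show "\<exists>y\<in>carrier N. y \<oplus>\<^bsub>N\<^esub> x = \<zero>\<^bsub>N\<^esub>"
      using car x' by blast
  qed
  moreover have "right_module_axioms R N"
    unfolding right_module_axioms_def
  proof (intro conjI allI impI)
    fix r x assume r: "r \<in> carrier R" and "x \<in> carrier N"
    then obtain x' where x': "x' \<in> carrier M" "x = h x'"
      using rep by meson
    then show "r \<odot>\<^bsub>N\<^esub> x \<in> carrier N"
      using r car by (simp add: scal smult_closed)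
    show "(r \<oplus>\<^bsub>R\<^esub> s) \<odot>\<^bsub>N\<^esub> x = (r \<odot>\<^bsub>N\<^esub> x) \<oplus>\<^bsub>N\<^esub> (s \<odot>\<^bsub>N\<^esub> x)"
      "(r \<otimes>\<^bsub>R\<^esub> s) \<odot>\<^bsub>N\<^esub> x = s \<odot>\<^bsub>N\<^esub> (r \<odot>\<^bsub>N\<^esub> x)" if "s \<in> carrier R" for s
      using x' r that by (simp_all add: sum scal smult_closed smult_l_distr smult_assoc)
    show "r \<odot>\<^bsub>N\<^esub> (x \<oplus>\<^bsub>N\<^esub> y) = (r \<odot>\<^bsub>N\<^esub> x) \<oplus>\<^bsub>N\<^esub> (r \<odot>\<^bsub>N\<^esub> y)" if y: "y \<in> carrier N" for y
    proof -
      obtain y' where "y' \<in> carrier M" "y = h y'"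
        using rep[OF y] by blast
      then show ?thesis
        using x' r by (simp add: sum scal smult_closed smult_r_distr)
    qed
  next
    show "\<one>\<^bsub>R\<^esub> \<odot>\<^bsub>N\<^esub> x = x" if "x \<in> carrier N" for x
      using rep[OF that] by (auto simp: scal smult_one)
  qed
  ultimately show ?thesis
    using R.ring_axioms by (simp add: right_module_def)
qed

lemma submodule_linear_image:
  assumes h: "linear_map R M N h" and N: "right_module R N" and X: "submodule X R M"
  shows "submodule (h ` X) R N"
proof -
  have [simp]: "x \<in> carrier M" if "x \<in> X" for x
    using that submodule_subset[OF X] by blast
  note [simp] = linear_mapD(3,4)[OF h, symmetric]
  show ?thesis
  proof (rule right_module.submoduleI[OF N])
    show "\<zero>\<^bsub>N\<^esub> \<in> h ` X"
      using linear_mapD(2)[OF h] submodule_zero[OF X] by force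
  qed (auto intro: linear_mapD(1)[OF h] submodule_add[OF X] submodule_smult[OF X])
qed

lemma submodule_linear_preimage:
  assumes h: "linear_map R M N h" and Y: "submodule Y R N"
  shows "submodule {x \<in> carrier M. h x \<in> Y} R M"
  by (rule submoduleI)
    (auto simp: linear_mapD[OF h] smult_closed
      intro: submodule_zero[OF Y] submodule_add[OF Y] submodule_smult[OF Y])

text \<open>If \<open>h x = h y\<close>, then \<open>x - y\<close> lies in the kernel, hence in
  \<open>X\<close>, and \<open>x = (x - y) + y\<close>.\<close>

lemma linear_eq_imp_mem:
  assumes h: "linear_map R M N h" and N: "right_module R N"
    and x: "x \<in> carrier M" and y: "y \<in> X" and "h x = h y"
    and X: "submodule X R M" and ker: "\<And>z. z \<in> carrier M \<Longrightarrow> h z = \<zero>\<^bsub>N\<^esub> \<Longrightarrow> z \<in> X"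
  shows "x \<in> X"
proof -
  interpret N: right_module R N by (rule N)
  have y': "y \<in> carrier M"
    using y submodule_subset[OF X] by blast
  \<comment> \<open>Trading \<open>h x\<close> for \<open>h y\<close> turns the value into the image
    of \<open>y - y\<close>, so \<open>h\<close> of a negative need not be computed.\<close>
  have "h (x \<oplus>\<^bsub>M\<^esub> \<ominus>\<^bsub>M\<^esub> y) = h y \<oplus>\<^bsub>N\<^esub> h (\<ominus>\<^bsub>M\<^esub> y)"
    using x y' \<open>h x = h y\<close> by (simp add: linear_mapD[OF h])
  also have "\<dots> = h (y \<oplus>\<^bsub>M\<^esub> \<ominus>\<^bsub>M\<^esub> y)"
    using y' by (simp add: linear_mapD[OF h])
  also have "\<dots> = \<zero>\<^bsub>N\<^esub>"
    using y' by (simp add: M.r_neg linear_mapD(2)[OF h])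
  finally have "x \<oplus>\<^bsub>M\<^esub> \<ominus>\<^bsub>M\<^esub> y \<in> X"
    using x y' by (intro ker) auto
  then have "(x \<oplus>\<^bsub>M\<^esub> \<ominus>\<^bsub>M\<^esub> y) \<oplus>\<^bsub>M\<^esub> y \<in> X"
    using y submodule_add[OF X] by blast
  then show ?thesis
    using x y' by (simp add: M.a_assoc M.l_neg)
qed

text \<open>A submodule that contains the kernel is determined by its image; this is the part of the
  correspondence theorem that concerns the full image.\<close>

lemma eq_carrier_of_linear_image:
  assumes h: "linear_map R M N h" and N: "right_module R N" and X: "submodule X R M"
    and ker: "\<And>z. z \<in> carrier M \<Longrightarrow> h z = \<zero>\<^bsub>N\<^esub> \<Longrightarrow> z \<in> X"
    and img: "h ` X = carrier N"
  shows "X = carrier M"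
proof
  show "X \<subseteq> carrier M"
    using X by (rule submodule_subset)
  show "carrier M \<subseteq> X"
  proof
    fix x assume x: "x \<in> carrier M"
    then obtain y where "y \<in> X" "h x = h y"
      using img linear_mapD(1)[OF h x] by blast
    then show "x \<in> X"
      using linear_eq_imp_mem[OF h N x _ _ X ker] by blast
  qed
qed

text \<open>Let \<open>X\<close> contain the preimage of \<open>P\<close>. By surjectivity the image
  of \<open>X\<close> contains \<open>P\<close>, so it is \<open>P\<close> or everything. In the
  first case \<open>X\<close> is the preimage; in the second \<open>X\<close> is all of
  \<open>M\<close>, because it contains the kernel.\<close>

lemma maximal_submodule_linear_preimage:
  assumes h: "linear_map R M N h" and surj: "h ` carrier M = carrier N"
    and P: "maximal_submodule R N P"
  shows "maximal_submodule R M {x \<in> carrier M. h x \<in> P}"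
proof -
  have N: "right_module R N"
    using h surj by (rule right_module_linear_image)
  have subP: "submodule P R N"
    using P by (simp add: maximal_submodule_def)
  let ?Y = "{x \<in> carrier M. h x \<in> P}"
  have "?Y \<noteq> carrier M"
  proof
    assume "?Y = carrier M"
    then have "h ` carrier M \<subseteq> P"
      by blast
    then have "P = carrier N"
      using surj submodule_subset[OF subP] by simp
    then show False
      using P by (simp add: maximal_submodule_def)
  qed
  moreover have "X = ?Y \<or> X = carrier M" if X: "submodule X R M" and le: "?Y \<subseteq> X" for X
  proof -
    have XM: "X \<subseteq> carrier M"
      using X by (rule submodule_subset)
    have "P \<subseteq> h ` ?Y"
      using submodule_subset[OF subP] unfolding surj[symmetric] by blast
    then have "P \<subseteq> h ` X"
      using le by blast
    then consider "h ` X = P" | "h ` X = carrier N"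
      using P submodule_linear_image[OF h N X] unfolding maximal_submodule_def by blast
    then show ?thesis
    proof cases
      case 1
      then show ?thesis
        using le XM by blast
    next
      case 2
      have ker: "z \<in> X" if "z \<in> carrier M" "h z = \<zero>\<^bsub>N\<^esub>" for z
        using that le submodule_zero[OF subP] by auto
      show ?thesis
        using eq_carrier_of_linear_image[OF h N X ker] 2 by blast
    qed
  qed
  ultimately show ?thesis
    using submodule_linear_preimage[OF h subP] by (simp add: maximal_submodule_def)
qed

end

text \<open>Carries the structure of a module along an injection; this moves modules into the
  carrier type fixed by \<^const>\<open>right_semiartinian\<close> and \<^const>\<open>right_max\<close>.\<close>

definition transport_module ::
    "('r, 'm, 'l) module_scheme \<Rightarrow> ('m \<Rightarrow> 'n) \<Rightarrow> ('r, 'n) module" where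
  "transport_module M \<phi> = (let \<psi> = inv_into (carrier M) \<phi> in
    \<lparr>carrier = \<phi> ` carrier M, mult = undefined, one = undefined,
     zero = \<phi> \<zero>\<^bsub>M\<^esub>, add = (\<lambda>a b. \<phi> (\<psi> a \<oplus>\<^bsub>M\<^esub> \<psi> b)), smult = (\<lambda>r a. \<phi> (r \<odot>\<^bsub>M\<^esub> \<psi> a))\<rparr>)"

lemma carrier_transport_module: "carrier (transport_module M \<phi>) = \<phi> ` carrier M"
  by (simp add: transport_module_def Let_def)

lemma linear_map_transport_module:
  "inj_on \<phi> (carrier M) \<Longrightarrow> linear_map R M (transport_module M \<phi>) \<phi>"
  by (auto simp: linear_map_def transport_module_def Let_def)

section \<open>Submodules regarded as modules, and simple submodules\<close>

context right_module
begin

lemma right_module_submodule: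
  assumes X: "submodule X R M"
  shows "right_module R (M\<lparr>carrier := X\<rparr>)"
proof -
  have [simp]: "x \<in> carrier M" if "x \<in> X" for x
    using that submodule_subset[OF X] by blast
  have "abelian_group (M\<lparr>carrier := X\<rparr>)"
  proof (rule abelian_groupI)
    fix x assume "x \<in> carrier (M\<lparr>carrier := X\<rparr>)"
    then show "\<exists>y\<in>carrier (M\<lparr>carrier := X\<rparr>).
        y \<oplus>\<^bsub>M\<lparr>carrier := X\<rparr>\<^esub> x = \<zero>\<^bsub>M\<lparr>carrier := X\<rparr>\<^esub>"
      using submodule_a_inv[OF X] by (auto intro!: bexI[of _ "\<ominus>\<^bsub>M\<^esub> x"] simp: M.l_neg)
  qed (auto intro: submodule_add[OF X] submodule_zero[OF X] simp: M.a_ac)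
  then show ?thesis
    unfolding right_module_def right_module_axioms_def
    using R.ring_axioms
    by (auto simp: smult_l_distr smult_r_distr smult_assoc smult_one
        intro: submodule_smult[OF X])
qed

lemma linear_map_inclusion: "X \<subseteq> carrier M \<Longrightarrow> linear_map R (M\<lparr>carrier := X\<rparr>) M id"
  by (auto simp: linear_map_def)

text \<open>Both directions use the inclusion of \<open>X\<close> into \<open>M\<close> as a linear
  map: one takes the image of \<open>Y\<close>, the other its preimage.\<close>

lemma submodule_of_submodule:
  assumes "submodule X R M" and "Y \<subseteq> X"
  shows "submodule Y R (M\<lparr>carrier := X\<rparr>) \<longleftrightarrow> submodule Y R M"
proof
  assume "submodule Y R (M\<lparr>carrier := X\<rparr>)"
  then show "submodule Y R M"
    using right_module.submodule_linear_image[OF right_module_submodule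
        linear_map_inclusion right_module_axioms, of X Y] assms submodule_subset[OF assms(1)]
    by simp
next
  assume "submodule Y R M"
  then show "submodule Y R (M\<lparr>carrier := X\<rparr>)"
    using right_module.submodule_linear_preimage[OF right_module_submodule
        linear_map_inclusion, of X Y] assms submodule_subset[OF assms(1)]
    by (simp add: Collect_conj_eq Int_absorb1)
qed

lemma simple_submodule_of_submodule:
  assumes X: "submodule X R M" and S: "simple_submodule R (M\<lparr>carrier := X\<rparr>) S"
  shows "simple_submodule R M S" and "S \<subseteq> X"
proof -
  show "S \<subseteq> X"
    using S submodule_subset[of S R "M\<lparr>carrier := X\<rparr>"] by (simp add: simple_submodule_def)
  then show "simple_submodule R M S"
    using S submodule_of_submodule[OF X] by (auto simp: simple_submodule_def)
qed

text \<open>Here \<open>h\<close> is an isomorphism, so lattices of submodules agree. This brings a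
  simple submodule of a transported copy back to the original module.\<close>

lemma simple_submodule_linear_preimage:
  assumes h: "linear_map R M N h" and surj: "h ` carrier M = carrier N"
    and inj: "inj_on h (carrier M)" and S: "simple_submodule R N S"
  shows "simple_submodule R M {x \<in> carrier M. h x \<in> S}"
proof -
  have N: "right_module R N"
    using h surj by (rule right_module_linear_image)
  have subS: "submodule S R N"
    using S by (simp add: simple_submodule_def)
  let ?P = "{x \<in> carrier M. h x \<in> S}"
  have "h ` ?P = S"
    using submodule_subset[OF subS] unfolding surj[symmetric] by blast
  then have "?P \<noteq> {\<zero>\<^bsub>M\<^esub>}"
    using S linear_mapD(2)[OF h] by (auto simp: simple_submodule_def)
  moreover have "X = {\<zero>\<^bsub>M\<^esub>} \<or> X = ?P" if X: "submodule X R M" and le: "X \<subseteq> ?P" for X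
  proof -
    have "h ` X \<subseteq> S"
      using le by blast
    then consider "h ` X = {\<zero>\<^bsub>N\<^esub>}" | "h ` X = S"
      using S submodule_linear_image[OF h N X] unfolding simple_submodule_def by blast
    then show ?thesis
    proof cases
      case 1
      have "x = \<zero>\<^bsub>M\<^esub>" if "x \<in> X" for x
        using that 1 le inj linear_mapD(2)[OF h] by (intro inj_onD[OF inj]) auto
      then show ?thesis
        using submodule_zero[OF X] by blast
    next
      case 2
      have "x \<in> X" if x: "x \<in> ?P" for x
      proof -
        obtain y where "y \<in> X" "h x = h y"
          using x 2 by blast
        then show ?thesis
          using x le inj_onD[OF inj, of x y] by blast
      qed
      then show ?thesis
        using le by blast
    qed
  qed
  ultimately show ?thesis
    using submodule_linear_preimage[OF h subS] by (simp add: simple_submodule_def)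
qed

section \<open>Quotients\<close>

lemma coset_eq:
  assumes "submodule K R M" and "k \<in> K" and "x \<in> carrier M"
  shows "K +>\<^bsub>M\<^esub> (k \<oplus>\<^bsub>M\<^esub> x) = K +>\<^bsub>M\<^esub> x"
proof -
  have K: "K \<subseteq> carrier M"
    using assms(1) by (rule submodule_subset)
  have "K +>\<^bsub>M\<^esub> k = K"
    using K assms submodule.axioms(1)[OF assms(1)] by (intro M.a_coset_join2) auto
  then show ?thesis
    using M.a_coset_add_assoc[OF K, of k x] assms K by auto
qed

lemma quotient_map:
  assumes K: "submodule K R M"
  shows "linear_map R M (quotient_module M K) (\<lambda>x. K +>\<^bsub>M\<^esub> x)"
    and "(\<lambda>x. K +>\<^bsub>M\<^esub> x) ` carrier M = carrier (quotient_module M K)"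
    and "right_module R (quotient_module M K)"
proof -
  have KM: "K \<subseteq> carrier M"
    using K by (rule submodule_subset)
  have sub: "abelian_subgroup K M"
    using submodule.axioms(1)[OF K] M.abelian_group_axioms
    by (intro abelian_subgroupI3 additive_subgroup.intro)
  show surj: "(\<lambda>x. K +>\<^bsub>M\<^esub> x) ` carrier M = carrier (quotient_module M K)"
    by (auto simp: quotient_module_def A_RCOSETS_def')
  \<comment> \<open>The product of a coset by \<open>r\<close> is a union over all its elements. For
    \<open>y = k + x\<close> the products of \<open>y\<close> and \<open>x\<close> by
    \<open>r\<close> differ by that of \<open>k\<close>, which is in \<open>K\<close>, so all sets
    in the union coincide; \<open>x\<close> itself shows that there is at least one.\<close>
  have "(\<Union>y\<in>K +>\<^bsub>M\<^esub> x. K +>\<^bsub>M\<^esub> (r \<odot>\<^bsub>M\<^esub> y)) = K +>\<^bsub>M\<^esub> (r \<odot>\<^bsub>M\<^esub> x)"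
    if r: "r \<in> carrier R" and x: "x \<in> carrier M" for r x
  proof -
    have "K +>\<^bsub>M\<^esub> (r \<odot>\<^bsub>M\<^esub> y) = K +>\<^bsub>M\<^esub> (r \<odot>\<^bsub>M\<^esub> x)" if y: "y \<in> K +>\<^bsub>M\<^esub> x" for y
    proof -
      obtain k where k: "k \<in> K" and "y = k \<oplus>\<^bsub>M\<^esub> x"
        using y by (auto simp: a_r_coset_def')
      then have "r \<odot>\<^bsub>M\<^esub> y = r \<odot>\<^bsub>M\<^esub> k \<oplus>\<^bsub>M\<^esub> r \<odot>\<^bsub>M\<^esub> x"
        using r x KM by (auto simp: smult_r_distr)
      then show ?thesis
        using coset_eq[OF K submodule_smult[OF K r k] smult_closed[OF r x]] by simp
    qed
    moreover have "x \<in> K +>\<^bsub>M\<^esub> x"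
      using submodule_zero[OF K] x by (force simp: a_r_coset_def')
    ultimately show ?thesis
      by blast
  qed
  then show lin: "linear_map R M (quotient_module M K) (\<lambda>x. K +>\<^bsub>M\<^esub> x)"
    using KM M.a_coset_add_zero[OF KM] abelian_subgroup.a_rcos_sum[OF sub] M.a_rcosetsI[OF KM]
    by (auto simp: linear_map_def quotient_module_def)
  show "right_module R (quotient_module M K)"
    using lin surj by (rule right_module_linear_image)
qed

lemma quotient_map_eq_zero:
  assumes "submodule K R M" and "x \<in> carrier M"
  shows "K +>\<^bsub>M\<^esub> x = \<zero>\<^bsub>quotient_module M K\<^esub> \<longleftrightarrow> x \<in> K"
proof
  assume "K +>\<^bsub>M\<^esub> x = \<zero>\<^bsub>quotient_module M K\<^esub>"
  moreover have "x \<in> K +>\<^bsub>M\<^esub> x"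
    using submodule_zero[OF assms(1)] assms(2) by (force simp: a_r_coset_def')
  ultimately show "x \<in> K"
    by (simp add: quotient_module_def)
next
  assume "x \<in> K"
  then show "K +>\<^bsub>M\<^esub> x = \<zero>\<^bsub>quotient_module M K\<^esub>"
    using coset_eq[OF assms(1), of x "\<zero>\<^bsub>M\<^esub>"] assms linear_mapD(2)[OF quotient_map(1)] by simp
qed

text \<open>Submodules of the quotient by \<open>K\<close> correspond to submodules of
  \<open>M\<close> containing \<open>K\<close>, so superfluity in the quotient becomes a condition
  inside \<open>M\<close>. From here on, quotients disappear from the treatment of
  \<open>lies_above\<close>.\<close>

lemma lies_above_iff:
  "lies_above R M L K \<longleftrightarrow> submodule L R M \<and> submodule K R M \<and> K \<subseteq> L \<and>
    (\<forall>X. submodule X R M \<longrightarrow> K \<subseteq> X \<longrightarrow> L <+>\<^bsub>M\<^esub> X = carrier M \<longrightarrow> X = carrier M)"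
proof (cases "submodule L R M \<and> submodule K R M \<and> K \<subseteq> L")
  case False
  then show ?thesis
    by (auto simp: lies_above_def)
next
  case True
  then have L: "submodule L R M" and K: "submodule K R M" and KL: "K \<subseteq> L"
    by auto
  define Q where "Q = quotient_module M K"
  define h where "h = (\<lambda>x. K +>\<^bsub>M\<^esub> x)"
  have h: "linear_map R M Q h" and surj: "h ` carrier M = carrier Q" and Q: "right_module R Q"
    using quotient_map[OF K] by (simp_all add: h_def Q_def)
  have ker: "h x = \<zero>\<^bsub>Q\<^esub> \<longleftrightarrow> x \<in> K" if "x \<in> carrier M" for x
    using quotient_map_eq_zero[OF K that] by (simp add: h_def Q_def)
  have "superfluous R Q (h ` L) \<longleftrightarrow>
    (\<forall>X. submodule X R M \<longrightarrow> K \<subseteq> X \<longrightarrow> L <+>\<^bsub>M\<^esub> X = carrier M \<longrightarrow> X = carrier M)" (is "_ = ?rhs")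
  proof
    assume sup: "superfluous R Q (h ` L)"
    show ?rhs
    proof (intro allI impI)
      fix X assume X: "submodule X R M" and KX: "K \<subseteq> X" and sum: "L <+>\<^bsub>M\<^esub> X = carrier M"
      \<comment> \<open>Additivity makes the image of \<open>L + X\<close> the sum of the images, so
        superfluity applies to the image of \<open>X\<close>.\<close>
      have "h (l \<oplus>\<^bsub>M\<^esub> x) = h l \<oplus>\<^bsub>Q\<^esub> h x" if "l \<in> L" "x \<in> X" for l x
        using that submodule_subset[OF L] submodule_subset[OF X] by (intro linear_mapD(3)[OF h]) auto
      then have "h ` L <+>\<^bsub>Q\<^esub> h ` X = h ` (L <+>\<^bsub>M\<^esub> X)"
        by (force simp: set_add_def')
      then have "h ` X = carrier Q"
        using sup sum surj submodule_linear_image[OF h Q X] by (simp add: superfluous_def)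
      then show "X = carrier M"
        using ker KX by (intro eq_carrier_of_linear_image[OF h Q X]) auto
    qed
  next
    assume rhs: ?rhs
    have "Y = carrier Q" if Y: "submodule Y R Q" and sum: "h ` L <+>\<^bsub>Q\<^esub> Y = carrier Q" for Y
    proof -
      let ?X = "{x \<in> carrier M. h x \<in> Y}"
      have X: "submodule ?X R M"
        using h Y by (rule submodule_linear_preimage)
      have KX: "K \<subseteq> ?X"
      proof
        fix x assume "x \<in> K"
        then show "x \<in> ?X"
          using ker[of x] submodule_subset[OF K] submodule_zero[OF Y] by auto
      qed
      have LX: "submodule (L <+>\<^bsub>M\<^esub> ?X) R M"
        using L X by (rule submodule_set_add)
      \<comment> \<open>The class of \<open>m\<close> is that of some \<open>l + x\<close> with
        \<open>l\<close> in \<open>L\<close> and \<open>x\<close> in the preimage of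
        \<open>Y\<close>. The difference is in the kernel \<open>K\<close>, which is contained in
        \<open>L\<close>.\<close>
      have "m \<in> L <+>\<^bsub>M\<^esub> ?X" if m: "m \<in> carrier M" for m
      proof -
        obtain l y where l: "l \<in> L" and y: "y \<in> Y" and eq: "h m = h l \<oplus>\<^bsub>Q\<^esub> y"
          using sum linear_mapD(1)[OF h m] by (auto simp: mem_set_add simp flip: sum)
        obtain x where x: "x \<in> carrier M" and "y = h x"
          using y submodule_subset[OF Y] surj by blast
        have "l \<in> carrier M"
          using l submodule_subset[OF L] by blast
        then have "h m = h (l \<oplus>\<^bsub>M\<^esub> x)"
          using eq \<open>y = h x\<close> linear_mapD(3)[OF h _ x, of l] by simp
        moreover have "l \<oplus>\<^bsub>M\<^esub> x \<in> L <+>\<^bsub>M\<^esub> ?X"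
          using l x y \<open>y = h x\<close> by (auto simp: mem_set_add)
        moreover have "z \<in> L <+>\<^bsub>M\<^esub> ?X" if "z \<in> carrier M" "h z = \<zero>\<^bsub>Q\<^esub>" for z
          using that ker KL set_add_upper(1)[OF L X] by blast
        ultimately show ?thesis
          using linear_eq_imp_mem[OF h Q m _ _ LX] by blast
      qed
      then have "L <+>\<^bsub>M\<^esub> ?X = carrier M"
        using submodule_subset[OF LX] by blast
      then have "?X = carrier M"
        using rhs X KX by blast
      then have "h ` carrier M \<subseteq> Y"
        by blast
      then show ?thesis
        using surj submodule_subset[OF Y] by simp
    qed
    then show "superfluous R Q (h ` L)"
      using submodule_linear_image[OF h Q L] by (simp add: superfluous_def)
  qed
  then show ?thesis
    using True by (simp add: lies_above_def quotient_submodule_def Q_def h_def)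
qed

section \<open>Simple and maximal submodules\<close>

text \<open>The hypothesis is applied to \<open>X\<close> as a module of its own, copied into the
  carrier type that the hypothesis speaks of. A simple submodule of the copy is then pulled back to
  \<open>X\<close>.\<close>

lemma right_semiartinian_simple_submodule:
  assumes semi: "right_semiartinian TYPE(('r + 'm) set) R"
    and X: "submodule X R M" and "X \<noteq> {\<zero>\<^bsub>M\<^esub>}"
  shows "\<exists>S. simple_submodule R M S \<and> S \<subseteq> X"
proof -
  \<comment> \<open>Singletons embed the elements of \<open>M\<close> into the fixed carrier
    type.\<close>
  define \<phi> :: "'m \<Rightarrow> ('r + 'm) set" where "\<phi> x = {Inr x}" for x
  define T where "T = transport_module (M\<lparr>carrier := X\<rparr>) \<phi>"
  interpret X: right_module R "M\<lparr>carrier := X\<rparr>"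
    using X by (rule right_module_submodule)
  have inj: "inj_on \<phi> (carrier (M\<lparr>carrier := X\<rparr>))"
    by (auto simp: \<phi>_def inj_on_def)
  have lin: "linear_map R (M\<lparr>carrier := X\<rparr>) T \<phi>"
    unfolding T_def using inj by (rule linear_map_transport_module)
  have surj: "\<phi> ` carrier (M\<lparr>carrier := X\<rparr>) = carrier T"
    by (simp add: T_def carrier_transport_module)
  interpret T: right_module R T
    using lin surj by (rule X.right_module_linear_image)
  have "carrier T \<noteq> {\<zero>\<^bsub>T\<^esub>}"
  proof
    assume "carrier T = {\<zero>\<^bsub>T\<^esub>}"
    then have "\<phi> ` X = {\<phi> \<zero>\<^bsub>M\<^esub>}"
      using surj linear_mapD(2)[OF lin] by simp
    then have "X \<subseteq> {\<zero>\<^bsub>M\<^esub>}"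
      by (auto simp: \<phi>_def)
    then have "X = {\<zero>\<^bsub>M\<^esub>}"
      using submodule_zero[OF X] by blast
    then show False
      using \<open>X \<noteq> {\<zero>\<^bsub>M\<^esub>}\<close> by simp
  qed
  then have "socle R T \<noteq> {\<zero>\<^bsub>T\<^esub>}"
    using semi T.right_module_axioms by (simp add: right_semiartinian_def)
  \<comment> \<open>The sum of the empty family is zero, so a non-zero socle forces a simple
    submodule to exist.\<close>
  moreover have "socle R T = {\<zero>\<^bsub>T\<^esub>}" if "{S. simple_submodule R T S} = {}"
    using submodule_Sum_least[OF T.submodule_zero_module, of "{}"]
      submodule_zero[OF T.submodule_submodule_Sum, of "{}"]
    unfolding socle_def that by blast
  ultimately obtain S where "simple_submodule R T S"
    by blast
  then show ?thesis
    using X.simple_submodule_linear_preimage[OF lin surj inj] simple_submodule_of_submodule[OF X]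
    by blast
qed

text \<open>Zorn's lemma, applied downwards to the non-zero submodules of \<open>X\<close>, yields a
  minimal one, which is simple. A non-empty chain has non-zero intersection: otherwise finitely many
  of its members would intersect in zero, but the intersection of a non-empty finite subchain is one
  of its members.\<close>

lemma finitely_cogenerated_simple_submodule:
  assumes fc: "finitely_cogenerated R M" and X: "submodule X R M" and "X \<noteq> {\<zero>\<^bsub>M\<^esub>}"
  shows "\<exists>S. simple_submodule R M S \<and> S \<subseteq> X"
proof -
  define \<A> where "\<A> = {N. submodule N R M \<and> N \<noteq> {\<zero>\<^bsub>M\<^esub>} \<and> N \<subseteq> X}"
  \<comment> \<open>The order is reversed, so that maximal elements are minimal submodules.\<close>
  define P where "P A B \<longleftrightarrow> B \<subseteq> A" for A B :: "'m set"
  have "\<exists>S\<in>\<A>. \<forall>N\<in>\<A>. P S N \<longrightarrow> N = S"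
  proof (rule predicate_Zorn)
    show "partial_order_on \<A> (relation_of P \<A>)"
      by (rule partial_order_on_relation_ofI) (auto simp: P_def)
    fix \<C> assume C: "\<C> \<in> Chains (relation_of P \<A>)"
    have CA: "\<C> \<subseteq> \<A>"
      using C by (auto simp: Chains_def relation_of_def)
    have chain: "A \<subseteq> B \<or> B \<subseteq> A" if "A \<in> \<C>" "B \<in> \<C>" for A B
      using C that by (auto simp: Chains_def relation_of_def P_def)
    show "\<exists>U\<in>\<A>. \<forall>N\<in>\<C>. P N U"
    proof (cases "\<C> = {}")
      case True
      then show ?thesis
        using assms by (auto simp: \<A>_def)
    next
      case False
      have sub: "submodule N R M" if "N \<in> \<C>" for N
        using that CA by (auto simp: \<A>_def)
      have "submodule_Inter M \<C> \<noteq> {\<zero>\<^bsub>M\<^esub>}"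
      proof
        assume "submodule_Inter M \<C> = {\<zero>\<^bsub>M\<^esub>}"
        then obtain \<F> where F: "finite \<F>" "\<F> \<subseteq> \<C>" "submodule_Inter M \<F> = {\<zero>\<^bsub>M\<^esub>}"
          using fc sub unfolding finitely_cogenerated_def by (elim allE[of _ \<C>]) auto
        show False
        proof (cases "\<F> = {}")
          \<comment> \<open>The empty family intersects in the whole module, which would then be
            zero although \<open>X\<close> is not.\<close>
          case True
          then have "carrier M = {\<zero>\<^bsub>M\<^esub>}"
            using F(3) by (simp add: submodule_Inter_def)
          then show False
            using \<open>X \<noteq> {\<zero>\<^bsub>M\<^esub>}\<close> submodule_subset[OF X] submodule_zero[OF X] by auto
        next
          case False
          have "subset.chain \<A> \<F>"
            using F(2) CA chain unfolding subset_chain_def by blast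
          then have "\<Inter>\<F> \<in> \<F>"
            using F(1) False by (intro Inter_in_chain)
          moreover have "\<Inter>\<F> = submodule_Inter M \<F>"
            using \<open>\<Inter>\<F> \<in> \<F>\<close> F(2) submodule_subset[OF sub] unfolding submodule_Inter_def by blast
          ultimately show False
            using F CA by (auto simp: \<A>_def)
        qed
      qed
      moreover have "submodule_Inter M \<C> \<subseteq> X"
        using False CA by (auto simp: \<A>_def submodule_Inter_def)
      ultimately have "submodule_Inter M \<C> \<in> \<A>"
        using submodule_submodule_Inter[of \<C>] sub by (auto simp: \<A>_def)
      moreover have "submodule_Inter M \<C> \<subseteq> N" if "N \<in> \<C>" for N
        using that by (auto simp: submodule_Inter_def)
      ultimately show ?thesis
        unfolding P_def by blast
    qed
  qed
  then obtain S where "S \<in> \<A>" and "\<And>N. N \<in> \<A> \<Longrightarrow> N \<subseteq> S \<Longrightarrow> N = S"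
    by (auto simp: P_def)
  then have "simple_submodule R M S \<and> S \<subseteq> X"
    by (auto simp: \<A>_def simple_submodule_def)
  then show ?thesis ..
qed

text \<open>The quotient of \<open>M\<close> by \<open>X\<close> is non-zero, so a copy of it has a
  maximal submodule; its preimage in \<open>M\<close> is maximal and contains the kernel
  \<open>X\<close>.\<close>

lemma right_max_maximal_submodule:
  assumes max: "right_max TYPE(('r + 'm) set) R"
    and X: "submodule X R M" and "X \<noteq> carrier M"
  shows "\<exists>Y. maximal_submodule R M Y \<and> X \<subseteq> Y"
proof -
  define Q where "Q = quotient_module M X"
  \<comment> \<open>Elements of the quotient are subsets of \<open>M\<close>, so taking images under
    \<open>Inr\<close> embeds them into the fixed carrier type.\<close>
  define \<phi> :: "'m set \<Rightarrow> ('r + 'm) set" where "\<phi> = image Inr"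
  define T where "T = transport_module Q \<phi>"
  define h where "h = \<phi> \<circ> (\<lambda>x. X +>\<^bsub>M\<^esub> x)"
  have inj: "inj \<phi>"
    by (simp add: \<phi>_def inj_on_def inj_image_eq_iff)
  have quot: "linear_map R M Q (\<lambda>x. X +>\<^bsub>M\<^esub> x)" "(\<lambda>x. X +>\<^bsub>M\<^esub> x) ` carrier M = carrier Q"
    using quotient_map[OF X] by (simp_all add: Q_def)
  have tr: "linear_map R Q T \<phi>"
    unfolding T_def using inj by (intro linear_map_transport_module) (rule inj_on_subset, auto)
  have lin: "linear_map R M T h"
    unfolding h_def using quot(1) tr by (rule linear_map_comp)
  have surj: "h ` carrier M = carrier T"
    unfolding h_def image_comp[symmetric] quot(2) by (simp add: T_def carrier_transport_module)
  have ker: "h x = \<zero>\<^bsub>T\<^esub> \<longleftrightarrow> x \<in> X" if "x \<in> carrier M" for x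
    using quotient_map_eq_zero[OF X that] inj_eq[OF inj]
    by (simp add: h_def Q_def flip: linear_mapD(2)[OF tr])
  have "carrier T \<noteq> {\<zero>\<^bsub>T\<^esub>}"
  proof
    assume "carrier T = {\<zero>\<^bsub>T\<^esub>}"
    then have "x \<in> X" if "x \<in> carrier M" for x
      using linear_mapD(1)[OF lin that] ker[OF that] by simp
    then show False
      using \<open>X \<noteq> carrier M\<close> submodule_subset[OF X] by blast
  qed
  then obtain P where P: "maximal_submodule R T P"
    using max right_module_linear_image[OF lin surj] unfolding right_max_def by blast
  then have "\<zero>\<^bsub>T\<^esub> \<in> P"
    unfolding maximal_submodule_def by (blast intro: submodule_zero)
  have "X \<subseteq> {x \<in> carrier M. h x \<in> P}"
  proof
    fix x assume "x \<in> X"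
    then show "x \<in> {x \<in> carrier M. h x \<in> P}"
      using ker[of x] \<open>\<zero>\<^bsub>T\<^esub> \<in> P\<close> submodule_subset[OF X] by auto
  qed
  then show ?thesis
    using maximal_submodule_linear_preimage[OF lin surj P] by blast
qed

text \<open>Zorn's lemma for the proper submodules containing \<open>X\<close>. If the union of a
  chain were all of \<open>M\<close>, the finite generating set would lie in a single member, which
  would then not be proper.\<close>

lemma finitely_generated_maximal_submodule:
  assumes fg: "finitely_generated R M" and X: "submodule X R M" and "X \<noteq> carrier M"
  shows "\<exists>Y. maximal_submodule R M Y \<and> X \<subseteq> Y"
proof -
  obtain S where S: "finite S" "S \<subseteq> carrier M" "submodule_span R M S = carrier M"
    using fg by (auto simp: finitely_generated_def)
  define \<A> where "\<A> = {N. submodule N R M \<and> X \<subseteq> N \<and> N \<noteq> carrier M}"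
  have "\<exists>Y\<in>\<A>. \<forall>N\<in>\<A>. Y \<subseteq> N \<longrightarrow> N = Y"
  proof (rule subset_Zorn_nonempty)
    show "\<A> \<noteq> {}"
      using assms by (auto simp: \<A>_def)
    fix \<C> assume ne: "\<C> \<noteq> {}" and chain: "subset.chain \<A> \<C>"
    have CA: "\<C> \<subseteq> \<A>"
      using chain by (simp add: subset_chain_def)
    have "subset.chain {N. submodule N R M} \<C>"
      using chain unfolding subset_chain_def \<A>_def by blast
    then have sub: "submodule (\<Union>\<C>) R M"
      using ne by (rule submodule_Union_chain)
    have "\<Union>\<C> \<noteq> carrier M"
    proof
      assume "\<Union>\<C> = carrier M"
      then obtain N where "N \<in> \<C>" "S \<subseteq> N"
        using finite_subset_Union_chain[OF S(1) _ ne chain] S(2) by blast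
      then have "carrier M \<subseteq> N" and N: "submodule N R M" and "N \<noteq> carrier M"
        using CA submodule_span_least[of N R M S] S(3) by (auto simp: \<A>_def)
      then show False
        using submodule_subset[OF N] by blast
    qed
    then show "\<Union>\<C> \<in> \<A>"
      using ne CA sub by (auto simp: \<A>_def)
  qed
  then obtain Y where "Y \<in> \<A>" and "\<And>N. N \<in> \<A> \<Longrightarrow> Y \<subseteq> N \<Longrightarrow> N = Y"
    by blast
  then have "maximal_submodule R M Y \<and> X \<subseteq> Y"
    by (auto simp: \<A>_def maximal_submodule_def)
  then show ?thesis ..
qed

section \<open>Projections\<close>

text \<open>The witness is the projection onto \<open>A\<close> along \<open>B\<close>.\<close>

lemma ex_projection:
  assumes A: "submodule A R M" and B: "submodule B R M"
    and int: "A \<inter> B = {\<zero>\<^bsub>M\<^esub>}" and sum: "A <+>\<^bsub>M\<^esub> B = carrier M"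
  shows "\<exists>p\<in>endomorphisms R M. p ` carrier M = A \<and> a_kernel M M p = B"
proof -
  have [simp]: "x \<in> carrier M" if "x \<in> A \<or> x \<in> B" for x
    using that submodule_subset[OF A] submodule_subset[OF B] by blast
  \<comment> \<open>Two decompositions of the same element give \<open>a - a' = b' - b\<close>,
    which lies in both \<open>A\<close> and \<open>B\<close> and is therefore zero.\<close>
  have uniq: "a = a'"
    if *: "a \<in> A" "a' \<in> A" "b \<in> B" "b' \<in> B" and eq: "a \<oplus>\<^bsub>M\<^esub> b = a' \<oplus>\<^bsub>M\<^esub> b'" for a a' b b'
  proof -
    have "a \<oplus>\<^bsub>M\<^esub> \<ominus>\<^bsub>M\<^esub> a' = (a \<oplus>\<^bsub>M\<^esub> b) \<oplus>\<^bsub>M\<^esub> (\<ominus>\<^bsub>M\<^esub> b \<oplus>\<^bsub>M\<^esub> \<ominus>\<^bsub>M\<^esub> a')"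
      using * by (simp add: M.a_assoc M.r_neg2)
    also have "\<dots> = (a' \<oplus>\<^bsub>M\<^esub> \<ominus>\<^bsub>M\<^esub> a') \<oplus>\<^bsub>M\<^esub> (b' \<oplus>\<^bsub>M\<^esub> \<ominus>\<^bsub>M\<^esub> b)"
      unfolding eq using * by (simp add: M.a_ac)
    also have "\<dots> = b' \<oplus>\<^bsub>M\<^esub> \<ominus>\<^bsub>M\<^esub> b"
      using * by (simp add: M.r_neg)
    finally have "a \<oplus>\<^bsub>M\<^esub> \<ominus>\<^bsub>M\<^esub> a' \<in> A \<inter> B"
      using * submodule_add[OF A *(1) submodule_a_inv[OF A *(2)]]
        submodule_add[OF B *(4) submodule_a_inv[OF B *(3)]] by simp
    then have "a \<oplus>\<^bsub>M\<^esub> \<ominus>\<^bsub>M\<^esub> a' = \<zero>\<^bsub>M\<^esub>"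
      using int by blast
    then have "(a \<oplus>\<^bsub>M\<^esub> \<ominus>\<^bsub>M\<^esub> a') \<oplus>\<^bsub>M\<^esub> a' = a'"
      using * by simp
    then show ?thesis
      using * by (simp add: M.a_assoc M.l_neg)
  qed
  have dec: "\<exists>a\<in>A. \<exists>b\<in>B. x = a \<oplus>\<^bsub>M\<^esub> b" if "x \<in> carrier M" for x
    using that unfolding sum[symmetric] by (simp add: mem_set_add)
  then have "\<forall>x\<in>carrier M. \<exists>a. a \<in> A \<and> (\<exists>b\<in>B. x = a \<oplus>\<^bsub>M\<^esub> b)"
    by blast
  then obtain p where p: "\<And>x. x \<in> carrier M \<Longrightarrow> p x \<in> A \<and> (\<exists>b\<in>B. x = p x \<oplus>\<^bsub>M\<^esub> b)"
    by metis
  \<comment> \<open>Choice only provides some component in \<open>A\<close> for each element.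
    Uniqueness fixes its value on every sum, and all properties of \<open>p\<close> follow from this
    rule.\<close>
  have p_eq: "p (a \<oplus>\<^bsub>M\<^esub> b) = a" if ab: "a \<in> A" "b \<in> B" for a b
  proof -
    have "a \<oplus>\<^bsub>M\<^esub> b \<in> carrier M"
      using ab by simp
    then obtain b' where "p (a \<oplus>\<^bsub>M\<^esub> b) \<in> A" "b' \<in> B" "a \<oplus>\<^bsub>M\<^esub> b = p (a \<oplus>\<^bsub>M\<^esub> b) \<oplus>\<^bsub>M\<^esub> b'"
      using p by blast
    then show ?thesis
      using uniq[of a "p (a \<oplus>\<^bsub>M\<^esub> b)" b b'] ab by simp
  qed
  have pA: "p a = a" if "a \<in> A" for a
    using p_eq[OF that submodule_zero[OF B]] that by simp
  have pB: "p b = \<zero>\<^bsub>M\<^esub>" if "b \<in> B" for b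
    using p_eq[OF submodule_zero[OF A] that] that by simp
  have "p (x \<oplus>\<^bsub>M\<^esub> y) = p x \<oplus>\<^bsub>M\<^esub> p y" if xy: "x \<in> carrier M" "y \<in> carrier M" for x y
  proof -
    obtain a b a' b' where *: "a \<in> A" "b \<in> B" "a' \<in> A" "b' \<in> B"
      and "x = a \<oplus>\<^bsub>M\<^esub> b" "y = a' \<oplus>\<^bsub>M\<^esub> b'"
      using dec[OF xy(1)] dec[OF xy(2)] by blast
    moreover from this have "x \<oplus>\<^bsub>M\<^esub> y = (a \<oplus>\<^bsub>M\<^esub> a') \<oplus>\<^bsub>M\<^esub> (b \<oplus>\<^bsub>M\<^esub> b')"
      by (simp add: M.a_ac)
    ultimately show ?thesis
      using p_eq submodule_add[OF A, of a a'] submodule_add[OF B, of b b'] by simp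
  qed
  moreover have "p (r \<odot>\<^bsub>M\<^esub> x) = r \<odot>\<^bsub>M\<^esub> p x" if r: "r \<in> carrier R" and x: "x \<in> carrier M" for r x
  proof -
    obtain a b where *: "a \<in> A" "b \<in> B" "x = a \<oplus>\<^bsub>M\<^esub> b"
      using dec[OF x] by blast
    then have "r \<odot>\<^bsub>M\<^esub> x = r \<odot>\<^bsub>M\<^esub> a \<oplus>\<^bsub>M\<^esub> r \<odot>\<^bsub>M\<^esub> b"
      using r by (simp add: smult_r_distr)
    then show ?thesis
      using p_eq * submodule_smult[OF A r, of a] submodule_smult[OF B r, of b] by simp
  qed
  ultimately have "p \<in> endomorphisms R M"
    using p by (auto simp: endomorphisms_def hom_def)
  moreover have "p ` carrier M = A"
  proof
    show "p ` carrier M \<subseteq> A"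
      using p by blast
    show "A \<subseteq> p ` carrier M"
      using pA submodule_subset[OF A] by (metis image_eqI subset_eq)
  qed
  moreover have "x \<in> B" if x: "x \<in> carrier M" and "p x = \<zero>\<^bsub>M\<^esub>" for x
  proof -
    obtain a b where *: "a \<in> A" "b \<in> B" "x = a \<oplus>\<^bsub>M\<^esub> b"
      using dec[OF x] by blast
    then show ?thesis
      using p_eq \<open>p x = \<zero>\<^bsub>M\<^esub>\<close> by simp
  qed
  then have "a_kernel M M p = B"
    using pB by (auto simp: mem_a_kernel)
  ultimately show ?thesis
    by blast
qed

lemma direct_summand_eq_image:
  "direct_summand R M D \<Longrightarrow> \<exists>p\<in>endomorphisms R M. p ` carrier M = D"
  unfolding direct_summand_def by (blast dest: ex_projection)

lemma direct_summand_eq_kernel: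
  assumes "direct_summand R M D"
  shows "\<exists>p\<in>endomorphisms R M. a_kernel M M p = D"
proof -
  obtain D' where D: "submodule D R M" "submodule D' R M"
    and *: "D \<inter> D' = {\<zero>\<^bsub>M\<^esub>}" "D <+>\<^bsub>M\<^esub> D' = carrier M"
    using assms by (auto simp: direct_summand_def)
  \<comment> \<open>The summands are swapped: \<open>D\<close> is the kernel of the projection onto
    its complement \<open>D'\<close>.\<close>
  have "carrier M \<subseteq> D' <+>\<^bsub>M\<^esub> D"
    unfolding *(2)[symmetric]
    using set_add_upper[OF D(2,1)] submodule_set_add[OF D(2,1)] by (intro set_add_least)
  then have "D' <+>\<^bsub>M\<^esub> D = carrier M"
    using submodule_subset[OF submodule_set_add[OF D(2,1)]] by blast
  then show ?thesis
    using ex_projection[OF D(2,1)] *(1) by (auto simp: Int_commute)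
qed

lemma linear_map_endomorphism:
  assumes "f \<in> endomorphisms R M"
  shows "linear_map R M M f"
proof -
  have closed: "f x \<in> carrier M" if "x \<in> carrier M" for x
    using assms that by (auto simp: endomorphisms_def hom_def)
  have add: "f (x \<oplus>\<^bsub>M\<^esub> y) = f x \<oplus>\<^bsub>M\<^esub> f y" if "x \<in> carrier M" "y \<in> carrier M" for x y
    using assms that by (auto simp: endomorphisms_def hom_def)
  have "f \<zero>\<^bsub>M\<^esub> = \<zero>\<^bsub>M\<^esub>"
    using add[of "\<zero>\<^bsub>M\<^esub>" "\<zero>\<^bsub>M\<^esub>"] closed[of "\<zero>\<^bsub>M\<^esub>"] by simp
  then show ?thesis
    using assms closed by (auto simp: linear_map_def endomorphisms_def hom_def)
qed

lemma submodule_image_endomorphism: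
  "f \<in> endomorphisms R M \<Longrightarrow> submodule (f ` carrier M) R M"
  using submodule_linear_image[OF linear_map_endomorphism right_module_axioms submodule_carrier] .

section \<open>Baer and Rickart conditions\<close>

text \<open>This replaces the summands \<open>D N\<close> by the submodules \<open>N\<close> while
  keeping \<open>K\<close>. Essentiality may get lost under infinite intersections, but a simple
  submodule of \<open>D N\<close> lies entirely in \<open>N\<close>, so simple submodules serve as
  test objects.\<close>

lemma essential_in_submodule_Inter:
  assumes simple: "\<And>X. submodule X R M \<Longrightarrow> X \<noteq> {\<zero>\<^bsub>M\<^esub>} \<Longrightarrow> \<exists>S. simple_submodule R M S \<and> S \<subseteq> X"
    and ess: "\<And>N. N \<in> \<N> \<Longrightarrow> essential_in R M N (D N)"
    and K: "essential_in R M (submodule_Inter M (D ` \<N>)) K"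
  shows "essential_in R M (submodule_Inter M \<N>) K"
proof -
  have N: "submodule (submodule_Inter M \<N>) R M"
    using ess by (intro submodule_submodule_Inter) (auto simp: essential_in_def)
  have "submodule_Inter M \<N> \<subseteq> submodule_Inter M (D ` \<N>)"
    using ess unfolding submodule_Inter_def essential_in_def by blast
  then have "submodule_Inter M \<N> \<subseteq> K"
    using K unfolding essential_in_def by blast
  moreover have "X = {\<zero>\<^bsub>M\<^esub>}"
    if X: "submodule X R M" "X \<subseteq> K" and zero: "submodule_Inter M \<N> \<inter> X = {\<zero>\<^bsub>M\<^esub>}" for X
  proof (rule ccontr)
    assume "X \<noteq> {\<zero>\<^bsub>M\<^esub>}"
    \<comment> \<open>Since the intersection of the \<open>D N\<close> is essential in
      \<open>K\<close>, it meets \<open>X\<close> in a non-zero submodule, which contains a simple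
      \<open>S\<close>.\<close>
    then have "submodule_Inter M (D ` \<N>) \<inter> X \<noteq> {\<zero>\<^bsub>M\<^esub>}"
      using K X unfolding essential_in_def by blast
    moreover have "submodule (submodule_Inter M (D ` \<N>) \<inter> X) R M"
      using K X by (intro submodule_Int) (auto simp: essential_in_def)
    ultimately obtain S where S: "simple_submodule R M S" "S \<subseteq> submodule_Inter M (D ` \<N>) \<inter> X"
      using simple by blast
    have subS: "submodule S R M"
      using S(1) by (simp add: simple_submodule_def)
    have "S \<subseteq> A" if A: "A \<in> \<N>" for A
    proof -
      have subA: "submodule A R M"
        using ess[OF A] by (simp add: essential_in_def)
      have "S \<subseteq> D A"
        using S(2) A by (auto simp: submodule_Inter_def)
      \<comment> \<open>As \<open>A\<close> is essential in \<open>D A\<close>, it meets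
        \<open>S\<close>; simplicity turns the intersection into all of \<open>S\<close>.\<close>
      then have "A \<inter> S \<noteq> {\<zero>\<^bsub>M\<^esub>}"
        using ess[OF A] subS S(1) unfolding essential_in_def simple_submodule_def by blast
      then have "A \<inter> S = S"
        using S(1) submodule_Int[OF subA subS] unfolding simple_submodule_def by blast
      then show ?thesis
        by blast
    qed
    then have "S \<subseteq> submodule_Inter M \<N> \<inter> X"
      using S(2) by (auto simp: submodule_Inter_def)
    then have "S = {\<zero>\<^bsub>M\<^esub>}"
      using zero submodule_zero[OF subS] by blast
    then show False
      using S(1) by (simp add: simple_submodule_def)
  qed
  ultimately show ?thesis
    using N K by (auto simp: essential_in_def)
qed

text \<open>Dual to the previous lemma, with maximal submodules as test objects: one that contains
  \<open>D N\<close> also contains \<open>N\<close>.\<close>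

lemma lies_above_submodule_Sum:
  assumes maximal: "\<And>X. submodule X R M \<Longrightarrow> X \<noteq> carrier M \<Longrightarrow> \<exists>Y. maximal_submodule R M Y \<and> X \<subseteq> Y"
    and above: "\<And>N. N \<in> \<N> \<Longrightarrow> lies_above R M N (D N)"
    and K: "lies_above R M (submodule_Sum R M (D ` \<N>)) K"
  shows "lies_above R M (submodule_Sum R M \<N>) K"
proof -
  let ?D = "submodule_Sum R M (D ` \<N>)" and ?N = "submodule_Sum R M \<N>"
  have subD: "submodule ?D R M" and "K \<subseteq> ?D"
    using K by (auto simp: lies_above_iff)
  have subN: "submodule ?N R M"
    using above by (intro submodule_submodule_Sum) (auto simp: lies_above_iff)
  have "D A \<subseteq> ?N" if "A \<in> \<N>" for A
    using above[OF that] submodule_Sum_upper[OF that] unfolding lies_above_iff by blast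
  then have "?D \<subseteq> ?N"
    using subN by (intro submodule_Sum_least) auto
  then have "K \<subseteq> ?N"
    using \<open>K \<subseteq> ?D\<close> by blast
  moreover have "X = carrier M"
    if X: "submodule X R M" "K \<subseteq> X" and sum: "?N <+>\<^bsub>M\<^esub> X = carrier M" for X
  proof (rule ccontr)
    assume "X \<noteq> carrier M"
    \<comment> \<open>If \<open>X\<close> is proper, so is its sum with all the \<open>D N\<close>,
      because that sum of summands lies above \<open>K\<close>; a maximal \<open>Y\<close> contains
      both.\<close>
    then have "?D <+>\<^bsub>M\<^esub> X \<noteq> carrier M"
      using K X unfolding lies_above_iff by blast
    then obtain Y where Y: "maximal_submodule R M Y" "?D <+>\<^bsub>M\<^esub> X \<subseteq> Y"
      using maximal[OF submodule_set_add[OF subD X(1)]] by blast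
    have subY: "submodule Y R M" and "Y \<noteq> carrier M"
      using Y(1) by (auto simp: maximal_submodule_def)
    have DY: "?D \<subseteq> Y" and XY: "X \<subseteq> Y"
      using set_add_upper[OF subD X(1)] Y(2) by auto
    have "A \<subseteq> Y" if A: "A \<in> \<N>" for A
    proof -
      have subA: "submodule A R M"
        using above[OF A] by (simp add: lies_above_iff)
      have "D A \<subseteq> Y"
        using submodule_Sum_upper[of "D A" "D ` \<N>" R M] A DY by blast
      \<comment> \<open>\<open>Y\<close> is proper and contains \<open>D A\<close>, above which
        \<open>A\<close> lies, so \<open>A + Y\<close> is proper; maximality then gives
        \<open>A + Y = Y\<close>.\<close>
      then have "A <+>\<^bsub>M\<^esub> Y \<noteq> carrier M"
        using above[OF A] subY \<open>Y \<noteq> carrier M\<close> unfolding lies_above_iff by blast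
      then have "A <+>\<^bsub>M\<^esub> Y = Y"
        using Y(1) submodule_set_add[OF subA subY] set_add_upper[OF subA subY]
        unfolding maximal_submodule_def by blast
      then show ?thesis
        using set_add_upper[OF subA subY] by blast
    qed
    then have "?N \<subseteq> Y"
      by (rule submodule_Sum_least[OF subY])
    then have "carrier M \<subseteq> Y"
      using set_add_least[OF subY _ XY, of ?N] sum by simp
    then show False
      using \<open>Y \<noteq> carrier M\<close> submodule_subset[OF subY] by blast
  qed
  ultimately show ?thesis
    using subN K by (auto simp: lies_above_iff)
qed

text \<open>The predicate \<open>P\<close> is trivial in the plain case and full invariance in the strong one.\<close>

lemma Baer_iff_Rickart_SSIP:
  assumes simple: "\<And>X. submodule X R M \<Longrightarrow> X \<noteq> {\<zero>\<^bsub>M\<^esub>} \<Longrightarrow> \<exists>S. simple_submodule R M S \<and> S \<subseteq> X"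
  shows "(\<forall>F \<subseteq> endomorphisms R M. \<exists>K. direct_summand R M K \<and> P K \<and>
      essential_in R M (submodule_Inter M (a_kernel M M ` F)) K) \<longleftrightarrow>
    (\<forall>f\<in>endomorphisms R M. \<exists>K. direct_summand R M K \<and> P K \<and>
      essential_in R M (a_kernel M M f) K) \<and>
    (\<forall>\<N>. (\<forall>N\<in>\<N>. \<exists>D. direct_summand R M D \<and> essential_in R M N D) \<longrightarrow>
      (\<exists>K. direct_summand R M K \<and> P K \<and> essential_in R M (submodule_Inter M \<N>) K))"
  (is "?Baer \<longleftrightarrow> ?Rickart \<and> ?SSIP")
proof (intro iffI conjI)
  assume baer: ?Baer
  show ?Rickart
  proof
    fix f assume "f \<in> endomorphisms R M"
    \<comment> \<open>The Rickart condition is the Baer condition for one-element families.\<close>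
    moreover have "submodule_Inter M (a_kernel M M ` {f}) = a_kernel M M f"
      by (auto simp: submodule_Inter_def mem_a_kernel)
    ultimately show "\<exists>K. direct_summand R M K \<and> P K \<and> essential_in R M (a_kernel M M f) K"
      using spec[OF baer, of "{f}"] by simp
  qed
  show ?SSIP
  proof (intro allI impI)
    fix \<N> assume N: "\<forall>N\<in>\<N>. \<exists>D. direct_summand R M D \<and> essential_in R M N D"
    obtain D where D: "\<And>N. N \<in> \<N> \<Longrightarrow> direct_summand R M (D N)"
      "\<And>N. N \<in> \<N> \<Longrightarrow> essential_in R M N (D N)"
      using bchoice[OF N] by blast
    \<comment> \<open>Writing each \<open>D N\<close> as a kernel lets the Baer condition handle the
      intersection of the \<open>D N\<close>; the same \<open>K\<close> then serves for the
      \<open>N\<close> themselves.\<close>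
    have "\<forall>N\<in>\<N>. \<exists>p. p \<in> endomorphisms R M \<and> a_kernel M M (p) = D N"
      using D(1) direct_summand_eq_kernel by blast
    from bchoice[OF this] obtain p where p: "\<And>N. N \<in> \<N> \<Longrightarrow> p N \<in> endomorphisms R M"
      "\<And>N. N \<in> \<N> \<Longrightarrow> a_kernel M M (p N) = D N"
      by blast
    have "a_kernel M M ` p ` \<N> = D ` \<N>"
      using p(2) by (simp add: image_image)
    moreover have "p ` \<N> \<subseteq> endomorphisms R M"
      using p(1) by blast
    ultimately obtain K where "direct_summand R M K" "P K"
      "essential_in R M (submodule_Inter M (D ` \<N>)) K"
      using spec[OF baer, of "p ` \<N>"] by auto
    then show "\<exists>K. direct_summand R M K \<and> P K \<and> essential_in R M (submodule_Inter M \<N>) K"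
      using essential_in_submodule_Inter[OF simple D(2)] by blast
  qed
next
  assume *: "?Rickart \<and> ?SSIP"
  show ?Baer
  proof (intro allI impI)
    \<comment> \<open>By the Rickart condition each kernel is essential in a summand, so the kernels
      form a family to which SSIP applies; its \<open>K\<close> also satisfies
      \<open>P\<close>.\<close>
    fix F assume "F \<subseteq> endomorphisms R M"
    then have "\<forall>N\<in>a_kernel M M ` F. \<exists>D. direct_summand R M D \<and> essential_in R M N D"
      using * by blast
    then show "\<exists>K. direct_summand R M K \<and> P K \<and> essential_in R M (submodule_Inter M (a_kernel M M ` F)) K"
      using * by blast
  qed
qed

lemma dual_Baer_iff_Rickart_SSSP:
  assumes maximal: "\<And>X. submodule X R M \<Longrightarrow> X \<noteq> carrier M \<Longrightarrow> \<exists>Y. maximal_submodule R M Y \<and> X \<subseteq> Y"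
  shows "(\<forall>F \<subseteq> endomorphisms R M. \<exists>K. direct_summand R M K \<and> P K \<and>
      lies_above R M (submodule_Sum R M ((\<lambda>f. f ` carrier M) ` F)) K) \<longleftrightarrow>
    (\<forall>f\<in>endomorphisms R M. \<exists>K. direct_summand R M K \<and> P K \<and>
      lies_above R M (f ` carrier M) K) \<and>
    (\<forall>\<N>. (\<forall>N\<in>\<N>. \<exists>D. direct_summand R M D \<and> lies_above R M N D) \<longrightarrow>
      (\<exists>K. direct_summand R M K \<and> P K \<and> lies_above R M (submodule_Sum R M \<N>) K))"
  (is "?Baer \<longleftrightarrow> ?Rickart \<and> ?SSSP")
proof (intro iffI conjI)
  assume baer: ?Baer
  show ?Rickart
  proof
    fix f assume f: "f \<in> endomorphisms R M"
    \<comment> \<open>The image of an endomorphism is already a submodule, so a sum with this single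
      member adds nothing.\<close>
    have "submodule_Sum R M ((\<lambda>f. f ` carrier M) ` {f}) = f ` carrier M"
      using submodule_Sum_least[OF submodule_image_endomorphism[OF f], of "{f ` carrier M}"]
        submodule_Sum_upper[of "f ` carrier M" "{f ` carrier M}" R M]
      by (simp add: subset_antisym)
    then show "\<exists>K. direct_summand R M K \<and> P K \<and> lies_above R M (f ` carrier M) K"
      using spec[OF baer, of "{f}"] f by simp
  qed
  show ?SSSP
  proof (intro allI impI)
    fix \<N> assume N: "\<forall>N\<in>\<N>. \<exists>D. direct_summand R M D \<and> lies_above R M N D"
    obtain D where D: "\<And>N. N \<in> \<N> \<Longrightarrow> direct_summand R M (D N)"
      "\<And>N. N \<in> \<N> \<Longrightarrow> lies_above R M N (D N)"
      using bchoice[OF N] by blast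
    \<comment> \<open>Here each \<open>D N\<close> is written as the image of a projection, so that
      the sum of the \<open>D N\<close> is a sum of images.\<close>
    have "\<forall>N\<in>\<N>. \<exists>p. p \<in> endomorphisms R M \<and> p ` carrier M = D N"
      using D(1) direct_summand_eq_image by blast
    from bchoice[OF this] obtain p where p: "\<And>N. N \<in> \<N> \<Longrightarrow> p N \<in> endomorphisms R M"
      "\<And>N. N \<in> \<N> \<Longrightarrow> p N ` carrier M = D N"
      by blast
    have "(\<lambda>f. f ` carrier M) ` p ` \<N> = D ` \<N>"
      using p(2) by (simp add: image_image)
    moreover have "p ` \<N> \<subseteq> endomorphisms R M"
      using p(1) by blast
    ultimately obtain K where "direct_summand R M K" "P K"
      "lies_above R M (submodule_Sum R M (D ` \<N>)) K"
      using spec[OF baer, of "p ` \<N>"] by auto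
    then show "\<exists>K. direct_summand R M K \<and> P K \<and> lies_above R M (submodule_Sum R M \<N>) K"
      using lies_above_submodule_Sum[OF maximal D(2)] by blast
  qed
next
  assume *: "?Rickart \<and> ?SSSP"
  show ?Baer
  proof (intro allI impI)
    fix F assume "F \<subseteq> endomorphisms R M"
    then have "\<forall>N\<in>(\<lambda>f. f ` carrier M) ` F. \<exists>D. direct_summand R M D \<and> lies_above R M N D"
      using * by blast
    then show "\<exists>K. direct_summand R M K \<and> P K \<and> lies_above R M (submodule_Sum R M ((\<lambda>f. f ` carrier M) ` F)) K"
      using * by blast
  qed
qed

end

theorem corollary7p5:
  fixes R :: "('r, 'k) ring_scheme" and M :: "('r, 'm, 'l) module_scheme"
  assumes "right_module R M"
  shows
    "(finitely_cogenerated R M \<or> right_semiartinian TYPE(('r + 'm) set) R \<longrightarrow>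
        (self_CS_Baer R M \<longleftrightarrow> self_CS_Rickart R M \<and> SSIP_extending R M) \<and>
        (strongly_self_CS_Baer R M \<longleftrightarrow>
          strongly_self_CS_Rickart R M \<and> strictly_SSIP_extending R M)) \<and>
     (finitely_generated R M \<or> right_max TYPE(('r + 'm) set) R \<longrightarrow>
        (dual_self_CS_Baer R M \<longleftrightarrow> dual_self_CS_Rickart R M \<and> SSSP_lifting R M) \<and>
        (dual_strongly_self_CS_Baer R M \<longleftrightarrow>
          dual_strongly_self_CS_Rickart R M \<and> strictly_SSSP_lifting R M))"
proof -
  interpret right_module R M
    by (rule assms)
  show ?thesis
  proof (intro conjI impI)
    assume "finitely_cogenerated R M \<or> right_semiartinian TYPE(('r + 'm) set) R"
    then have simple: "\<exists>S. simple_submodule R M S \<and> S \<subseteq> X"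
      if "submodule X R M" "X \<noteq> {\<zero>\<^bsub>M\<^esub>}" for X
      using that finitely_cogenerated_simple_submodule right_semiartinian_simple_submodule by blast
    note iff = Baer_iff_Rickart_SSIP[OF simple]
    show "self_CS_Baer R M \<longleftrightarrow> self_CS_Rickart R M \<and> SSIP_extending R M"
      \<comment> \<open>A constantly true predicate gives the version without full
        invariance.\<close>
      using iff[of "\<lambda>_. True"]
      unfolding self_CS_Baer_def self_CS_Rickart_def SSIP_extending_def by simp
    show "strongly_self_CS_Baer R M \<longleftrightarrow>
        strongly_self_CS_Rickart R M \<and> strictly_SSIP_extending R M"
      unfolding strongly_self_CS_Baer_def strongly_self_CS_Rickart_def strictly_SSIP_extending_def
      by (rule iff)
  next
    assume "finitely_generated R M \<or> right_max TYPE(('r + 'm) set) R"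
    then have maximal: "\<exists>Y. maximal_submodule R M Y \<and> X \<subseteq> Y"
      if "submodule X R M" "X \<noteq> carrier M" for X
      using that finitely_generated_maximal_submodule right_max_maximal_submodule by blast
    note iff = dual_Baer_iff_Rickart_SSSP[OF maximal]
    show "dual_self_CS_Baer R M \<longleftrightarrow> dual_self_CS_Rickart R M \<and> SSSP_lifting R M"
      using iff[of "\<lambda>_. True"]
      unfolding dual_self_CS_Baer_def dual_self_CS_Rickart_def SSSP_lifting_def by simp
    show "dual_strongly_self_CS_Baer R M \<longleftrightarrow>
        dual_strongly_self_CS_Rickart R M \<and> strictly_SSSP_lifting R M"
      unfolding dual_strongly_self_CS_Baer_def dual_strongly_self_CS_Rickart_def
        strictly_SSSP_lifting_def
      by (rule iff)
  qed
qed

end
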